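(* Let $\mathcal D=\{(X_i,A_i,Y_i)\}_{i=1}^n$ be the i.i.d. data from a randomized experiment with known treatment probabilities $\pi_0,\pi_1$, let $\theta=\mathbb E[Y(1)-Y(0)]$, and let $\psi_i(h)$, $\psi(h)$ and the AIPW estimator $\widehat\theta(h)$ be as described in the context. Let $\widehat h$ be an outcome regression model trained on an auxiliary sample $\tilde{\mathcal D}$ independent of $\mathcal D$, and let $h^\dagger$ be a square-integrable function (the asymptotic limit of $\widehat h$) such that for $a\in\{0,1\}$, $\|\widehat h(\cdot,a)-h^\dagger(\cdot,a)\|_{L^2(\mathbb P)}\to 0$ in probability under the joint law $\mathbb P^\ast$ of $(\mathcal D,\tilde{\mathcal D})$ as $n\to\infty$. Let $f_1,\dots,f_k:\mathbb R^d\times\{0,1\}\to\mathbb R$ be square-integrable outcome models (foundation models) trained on independent external data. Let $$\Sigma=\operatorname{Cov}\big[(\psi(h^\dagger),\psi(f_1),\dots,\psi(f_k))^\top\big]\in\mathbb R^{(k+1)\times(k+1)},$$ let $\widehat\Sigma$ be its sample estimate, let $\widehat\lambda=\widehat\Sigma^{-1}\mathbf 1/(\mathbf 1^\top\widehat\Sigma^{-1}\mathbf 1)$, and let the hybrid (H-AIPW) estimator be $$\widehat\theta_{\widehat\lambda}=\widehat\lambda_1\,\widehat\theta(\widehat h)+\sum_{j=1}^k\widehat\lambda_{j+1}\,\widehat\theta(f_j).$$ Assume that $\Sigma$ is non-singular and $\widehat\Sigma\to\Sigma$ in probability. Then $$\sqrt n\,\big(\widehat\theta_{\widehat\lambda}-\theta\big)\rightsquigarrow\mathcal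 N(0,V_{\lambda^\star}),$$ where $\lambda^\star=\arg\min_{\lambda\in\Lambda}\lambda^\top\Sigma\lambda=\Sigma^{-1}\mathbf 1/(\mathbf 1^\top\Sigma^{-1}\mathbf 1)$, $\Lambda=\{\lambda\in\mathbb R^{k+1}:\sum_{j=1}^{k+1}\lambda_j=1\}$, and $V_{\lambda^\star}=\lambda^{\star\top}\Sigma\lambda^\star$. Moreover, the asymptotic variance of the combined estimator is no greater than that of any individual estimator: $$V_{\lambda^\star}\le\Sigma_{jj}\quad\text{for } j=1,\dots,k+1.$$
   Context: Setting. Let $\mathbb P$ be a joint distribution of $(X,Y(0),Y(1),Y,A)$ with covariates $X\in\mathbb R^d$, treatment $A\in\{0,1\}$, potential outcomes $(Y(0),Y(1))\in\mathbb R^2$ and bounded observed outcome $Y=Y(A)\in\mathbb R$. The experimental dataset $\mathcal D=\{(X_i,A_i,Y_i)\}_{i=1}^n$ is drawn i.i.d. from $\mathbb P$ (only $X,A,Y$ are observed). Expectations and covariances are under $\mathbb P$. Standing assumptions (randomized experiment). (i) $Y(a)$ is independent of $A$ for $a=0,1$; the treatment is randomized so $A$ is also independent of $X$; (ii) $\pi_a=\mathbb P(A=a)>0$ for $a=0,1$. The probabilities $\pi_0,\pi_1$ are known. AIPW estimator. For a square-integrable function $h:\mathbb R^d\times\{0,1\}\to\mathbb R$ (i.e. $h(X,a)$ is square-integrable for $a=0,1$) define $$\psi_i(h)=\Big(\tfrac{A_i}{\pi_1}(Y_i-h(X_i,1))+h(X_i,1)\Big)-\Big(\tfrac{1-A_i}{\pi_0}(Y_i-h(X_i,0))+h(X_i,0)\Big),\qquad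 \widehat\theta(h)=\frac1n\sum_{i=1}^n\psi_i(h),$$ and let $\psi(h)$ denote the same expression with $(X_i,A_i,Y_i)$ replaced by a generic $(X,A,Y)\sim\mathbb P$. Covariance estimate. Writing $\Psi_i=(\psi_i(\widehat h),\psi_i(f_1),\dots,\psi_i(f_k))$ (a row vector) and $\bar\psi=\frac1n\sum_{i=1}^n\Psi_i$, $$\widehat\Sigma=\frac1{n-1}\sum_{i=1}^n(\Psi_i-\bar\psi)^\top(\Psi_i-\bar\psi).$$ The weights $\widehat\lambda$ minimize $\lambda^\top\widehat\Sigma\lambda$ over $\Lambda$ (they are given by the stated formula whenever $\widehat\Sigma$ is invertible, which happens with probability tending to one). Conventions. $\mathbf 1\in\mathbb R^{k+1}$ is the all-ones vector. $\rightsquigarrow$ denotes convergence in distribution as $n\to\infty$. The number $k$ is fixed. The models $f_1,\dots,f_k$ do not depend on $\mathcal D$ and are treated as fixed functions. The auxiliary sample $\tilde{\mathcal D}$, and hence $\widehat h$, may depend on $n$. For a function $g$ of the covariates, $\|g\|_{L^2(\mathbb P)}^2=\int g(x)^2\,d\mathbb P_X(x)$, where $\mathbb P_X$ is the marginal law of $X$; when $g$ depends on $\widehat h$ this norm is a random variable, computed with $\widehat h$ held fixed. *)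

theory Defs
  imports "HOL-Probability.Probability"
begin

section \<open>Probability notions missing from the library\<close>

text \<open>The library's \<open>indep_var\<close> requires both variables to take values in the same type. This is the
  characterisation \<open>indep_var_eq\<close>, with the value types allowed to differ.\<close>

definition indep_rv ::
  "'p measure \<Rightarrow> 'a measure \<Rightarrow> ('p \<Rightarrow> 'a) \<Rightarrow> 'b measure \<Rightarrow> ('p \<Rightarrow> 'b) \<Rightarrow> bool" where
  "indep_rv M S U T V \<longleftrightarrow> U \<in> M \<rightarrow>\<^sub>M S \<and> V \<in> M \<rightarrow>\<^sub>M T \<and>
     prob_space.indep_set M {U -` B \<inter> space M | B. B \<in> sets S} {V -` B \<inter> space M | B. B \<in> sets T}"

definition covariance :: "'p measure \<Rightarrow> ('p \<Rightarrow> real) \<Rightarrow> ('p \<Rightarrow> real) \<Rightarrow> real" where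
  "covariance M U V =
     (\<integral>p. (U p - (\<integral>q. U q \<partial>M)) * (V p - (\<integral>q. V q \<partial>M)) \<partial>M)"

text \<open>The probability space may change with \<open>n\<close>.\<close>

definition tendsto_in_prob ::
  "(nat \<Rightarrow> 'w measure) \<Rightarrow> (nat \<Rightarrow> 'w \<Rightarrow> 'b::metric_space) \<Rightarrow> 'b \<Rightarrow> bool" where
  "tendsto_in_prob \<Omega> U c \<longleftrightarrow>
     (\<forall>\<epsilon>>0. (\<lambda>n. measure (\<Omega> n) {\<omega> \<in> space (\<Omega> n). \<epsilon> < dist (U n \<omega>) c}) \<longlonglongrightarrow> 0)"

text \<open>Parametrised by the variance \<open>v\<close>, whereas \<open>normal_density\<close> takes the standard deviation and
  does not cover the degenerate case.\<close>

definition normal_dist :: "real \<Rightarrow> real \<Rightarrow> real measure" where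
  "normal_dist m v =
     (if v = 0 then return borel m else density lborel (\<lambda>x. ennreal (normal_density m (sqrt v) x)))"

definition L2_norm_fun :: "'x measure \<Rightarrow> ('x \<Rightarrow> real) \<Rightarrow> real" where
  "L2_norm_fun \<mu> g = sqrt (\<integral>x. (g x)\<^sup>2 \<partial>\<mu>)"

section \<open>Outcome models and the AIPW estimator\<close>

text \<open>The treatment set \<open>{0, 1}\<close> is \<open>bool\<close>, with 1 for \<open>True\<close>; an observation is a triple
  \<open>(x, a, y)\<close> of covariates, treatment and outcome.\<close>

type_synonym 'd obs = "(real ^ 'd) \<times> bool \<times> real"
type_synonym 'd outcome_model = "real ^ 'd \<Rightarrow> bool \<Rightarrow> real"

abbreviation obs_space :: "('d::finite) obs measure" where
  "obs_space \<equiv> borel \<Otimes>\<^sub>M (count_space UNIV \<Otimes>\<^sub>M borel)"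

definition square_integrable_model ::
  "(real ^ 'd) measure \<Rightarrow> ('d::finite) outcome_model \<Rightarrow> bool" where
  "square_integrable_model \<mu> h \<longleftrightarrow>
     (\<forall>a. (\<lambda>x. h x a) \<in> borel_measurable \<mu> \<and> integrable \<mu> (\<lambda>x. (h x a)\<^sup>2))"

definition aipw_score ::
  "(bool \<Rightarrow> real) \<Rightarrow> ('d::finite) outcome_model \<Rightarrow> 'd obs \<Rightarrow> real" where
  "aipw_score \<pi> h = (\<lambda>(x, a, y).
     (of_bool a / \<pi> True * (y - h x True) + h x True)
     - ((1 - of_bool a) / \<pi> False * (y - h x False) + h x False))"

definition aipw_est ::
  "(bool \<Rightarrow> real) \<Rightarrow> nat \<Rightarrow> (nat \<Rightarrow> 'd obs) \<Rightarrow> ('d::finite) outcome_model \<Rightarrow> real" where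
  "aipw_est \<pi> n D h = (1 / real n) * (\<Sum>i<n. aipw_score \<pi> h (D i))"

section \<open>Combining several estimators\<close>

text \<open>With \<open>k = CARD('k)\<close> foundation models, the \<open>k + 1\<close> coordinates are indexed by \<open>'k option\<close>:
  \<open>None\<close> is the first coordinate (the model \<open>h\<close>) and \<open>Some j\<close> the coordinate of \<open>f j\<close>.\<close>

definition score_vec ::
  "(bool \<Rightarrow> real) \<Rightarrow> ('d::finite) outcome_model \<Rightarrow> ('k::finite \<Rightarrow> 'd outcome_model) \<Rightarrow> 'd obs
     \<Rightarrow> real ^ 'k option" where
  "score_vec \<pi> h f z =
     (\<chi> j. case j of None \<Rightarrow> aipw_score \<pi> h z | Some i \<Rightarrow> aipw_score \<pi> (f i) z)"

definition cov_matrix :: "'p measure \<Rightarrow> ('p \<Rightarrow> real ^ 'm) \<Rightarrow> real ^ 'm ^ 'm" where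
  "cov_matrix M U = (\<chi> i j. covariance M (\<lambda>p. U p $ i) (\<lambda>p. U p $ j))"

definition sample_mean :: "nat \<Rightarrow> (nat \<Rightarrow> real ^ 'm) \<Rightarrow> real ^ 'm" where
  "sample_mean n \<Psi> = (1 / real n) *\<^sub>R (\<Sum>i<n. \<Psi> i)"

definition sample_cov :: "nat \<Rightarrow> (nat \<Rightarrow> real ^ 'm) \<Rightarrow> real ^ 'm ^ 'm" where
  "sample_cov n \<Psi> = (\<chi> a b. 1 / (real n - 1) *
     (\<Sum>i<n. (\<Psi> i - sample_mean n \<Psi>) $ a * (\<Psi> i - sample_mean n \<Psi>) $ b))"

definition weight_set :: "(real ^ 'm) set" where
  "weight_set = {w. (\<Sum>j\<in>UNIV. w $ j) = 1}"

definition quad_form :: "real ^ 'm ^ 'm \<Rightarrow> real ^ 'm \<Rightarrow> real" where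
  "quad_form S w = w \<bullet> (S *v w)"

text \<open>Meaningful only for invertible \<open>S\<close>; \<open>vec 1\<close> is the all-ones vector.\<close>

definition inv_weights :: "real ^ 'm ^ 'm \<Rightarrow> real ^ 'm" where
  "inv_weights S = (1 / (vec 1 \<bullet> (matrix_inv S *v vec 1))) *\<^sub>R (matrix_inv S *v vec 1)"

definition hybrid_est ::
  "(bool \<Rightarrow> real) \<Rightarrow> nat \<Rightarrow> (nat \<Rightarrow> 'd obs) \<Rightarrow> ('d::finite) outcome_model
     \<Rightarrow> ('k::finite \<Rightarrow> 'd outcome_model) \<Rightarrow> real ^ 'k option \<Rightarrow> real" where
  "hybrid_est \<pi> n D h f w =
     w $ None * aipw_est \<pi> n D h + (\<Sum>j\<in>UNIV. w $ Some j * aipw_est \<pi> n D (f j))"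

end

theory Submission
  imports Defs
begin

text \<open>
  Write \<open>\<psi>\<^sub>j\<close> for the score of the \<open>j\<close>-th model, with \<open>h_lim\<close> in place of the trained model. Since treatment
  is randomised, every \<open>\<psi>\<^sub>j\<close> has mean \<open>\<theta>\<close>, so for weights summing to one the error of the hybrid estimator
  is a weighted sum of centred averages. Two scores with different outcome models differ by a
  contrast of mean zero whose second moment is bounded by the \<open>L\<^sup>2\<close> distance of the models. Given
  the auxiliary sample, Chebyshev's inequality therefore shows that replacing the trained model by \<open>h_lim\<close>
  changes the scaled error by \<open>o\<^sub>P(1)\<close>. The estimated weights converge in probability because
  \<open>inv_weights\<close> is continuous at the invertible matrix \<open>S\<close> (Cramer's rule); multiplied by
  the stochastically bounded scaled errors, their deviation is also \<open>o\<^sub>P(1)\<close>. What remains is an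
  i.i.d. sum with the fixed weights \<open>w_opt\<close>, to which the central limit theorem and Slutsky's lemma apply;
  both are used through characteristic functions, as the probability space varies with \<open>n\<close>.
\<close>

section \<open>Quadratic forms and minimal weights\<close>

text \<open>The data for different \<open>n\<close> live on unrelated probability spaces, so there
  is no single i.i.d. sequence to which a central limit theorem could be applied. A normalised row
  sum, however, has a characteristic function that is an \<open>n\<close>-th power determined by the
  law of one observation alone; the limit of these powers is computed on an auxiliary infinite
  product space and carries over to the rows. With the true treatment probabilities, the effect of
  any fixed change of the outcome model on the score has mean exactly zero, so the trained model
  needs consistency without a rate, and its independence of the data replaces any complexity
  condition. The estimated weights depend on the data and are arbitrary where the sample covariance
  is singular; the error of their sum, although multiplied by \<open>sqrt n\<close>, vanishes
  identically on an event of probability tending to one. A non-singular covariance matrix is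
  positive definite, which yields the minimal weights, their uniqueness and a positive limiting
  variance by which the sums can be standardised.\<close>

lemma continuous_det:
  fixes F :: "'a::t2_space \<Rightarrow> real^'n^'n"
  assumes "\<And>i j. continuous (at x) (\<lambda>y. F y $ i $ j)"
  shows "continuous (at x) (\<lambda>y. det (F y))"
  unfolding det_def by (intro continuous_intros assms)

lemma matrix_inv_right_real:
  fixes M :: "real^'n^'n"
  assumes "invertible M"
  shows "M ** matrix_inv M = mat 1"
  using assms by (metis (mono_tags, lifting) invertible_def matrix_inv_def someI_ex)

lemma matrix_vector_mult_matrix_inv:
  fixes M :: "real^'n^'n"
  assumes "invertible M"
  shows "M *v (matrix_inv M *v b) = b"
  using matrix_inv_right_real[OF assms] by (simp add: matrix_vector_mul_assoc)

text \<open>The determinant is continuous and nonzero at \<open>S\<close>. Near the limit the sample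
  covariance is therefore invertible, which is exactly where the estimated weights are
  prescribed.\<close>

lemma eventually_invertible:
  fixes S :: "real^'n^'n"
  assumes "invertible S"
  shows "eventually invertible (nhds S)"
proof -
  have "continuous (at S) (\<lambda>M::real^'n^'n. det M)"
    by (intro continuous_det continuous_intros)
  hence "((\<lambda>M::real^'n^'n. det M) \<longlongrightarrow> det S) (at S)" by (simp add: continuous_at)
  moreover have "det S \<noteq> 0" using assms invertible_det_nz by blast
  ultimately have "eventually (\<lambda>M::real^'n^'n. det M \<noteq> 0) (at S)"
    by (rule tendsto_imp_eventually_ne)
  hence "eventually invertible (at S)"
    by eventually_elim (simp add: invertible_det_nz)
  with assms show ?thesis by (simp add: eventually_nhds_conv_at)
qed

text \<open>Cramer's rule writes each coordinate as a quotient of determinants, hence of continuous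
  functions. The formula agrees with the inverse only at invertible matrices, so it is used as an
  eventual equality. The filter is \<open>nhds\<close> rather than \<open>at\<close> because the
  sample covariance may equal its limit.\<close>

lemma tendsto_matrix_inv_mult:
  fixes S :: "real^'n^'n"
  assumes "invertible S"
  shows "((\<lambda>M. matrix_inv M *v b) \<longlongrightarrow> matrix_inv S *v b) (nhds S)"
proof -
  define C :: "real^'n^'n \<Rightarrow> real^'n"
    where "C M = (\<chi> k. det (\<chi> i j. if j = k then b $ i else M $ i $ j) / det M)" for M
  have C: "matrix_inv M *v b = C M" if "invertible M" for M :: "real^'n^'n"
    using cramer[of M "matrix_inv M *v b" b] matrix_vector_mult_matrix_inv[OF that] that
    by (simp add: invertible_det_nz C_def)
  have d0: "det S \<noteq> 0" using assms invertible_det_nz by blast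
  have entry: "continuous (at S) (\<lambda>M::real^'n^'n.
      (\<chi> i j. if j = k then b $ i else M $ i $ j) $ i' $ j')" for k i' j'
    by (cases "j' = k") (auto intro!: continuous_intros)
  have "continuous (at S) (\<lambda>M::real^'n^'n. det (\<chi> i j. if j = k then b $ i else M $ i $ j))" for k
    by (rule continuous_det, rule entry)
  moreover have "continuous (at S) (\<lambda>M::real^'n^'n. det M)"
    by (intro continuous_det continuous_intros)
  ultimately have "continuous (at S) (\<lambda>M. C M $ k)" for k
    unfolding C_def vec_lambda_beta using d0 by (intro continuous_divide) auto
  hence "continuous (at S) C"
    unfolding continuous_at by (intro vec_tendstoI) simp
  hence "(C \<longlongrightarrow> C S) (nhds S)"
    by (simp add: continuous_at tendsto_at_iff_tendsto_nhds)
  hence "((\<lambda>M. matrix_inv M *v b) \<longlongrightarrow> C S) (nhds S)"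
    by (rule Lim_transform_eventually)
       (use eventually_invertible[OF assms] in eventually_elim, simp add: C)
  thus ?thesis by (simp add: C[OF assms])
qed

lemma tendsto_inv_weights:
  fixes S :: "real^'n^'n"
  assumes "invertible S" and "vec 1 \<bullet> (matrix_inv S *v vec 1) \<noteq> 0"
  shows "(inv_weights \<longlongrightarrow> inv_weights S) (nhds S)"
  unfolding inv_weights_def using assms
  by (intro tendsto_intros tendsto_matrix_inv_mult) auto

section \<open>Weights summing to one and positive definite quadratic forms\<close>

lemma weight_set_iff: "w \<in> weight_set \<longleftrightarrow> vec 1 \<bullet> w = 1"
  by (simp add: weight_set_def inner_vec_def)

lemma inv_weights_in_weight_set:
  assumes "vec 1 \<bullet> (matrix_inv S *v vec 1) \<noteq> 0"
  shows "inv_weights S \<in> weight_set"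
  using assms by (simp add: weight_set_iff inv_weights_def)

lemma quad_form_axis: "quad_form S (axis j 1) = S $ j $ j"
  by (simp add: quad_form_def inner_axis' matrix_vector_mult_basis column_def del: matrix_vector_mul_component)

lemma inner_symmetric_matrix:
  fixes S :: "real^'n^'n"
  assumes "transpose S = S"
  shows "x \<bullet> (S *v y) = y \<bullet> (S *v x)"
  by (metis assms dot_lmul_matrix inner_commute transpose_matrix_vector)

lemma quad_form_add:
  fixes S :: "real^'n^'n"
  assumes "transpose S = S"
  shows "quad_form S (x + y) = quad_form S x + 2 * (y \<bullet> (S *v x)) + quad_form S y"
  using inner_symmetric_matrix[OF assms, of x y]
  by (simp add: quad_form_def matrix_vector_right_distrib inner_add_left inner_add_right)

lemma quad_form_scaleR: "quad_form S (c *\<^sub>R x) = c\<^sup>2 * quad_form S x"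
  by (simp add: quad_form_def matrix_vector_mult_scaleR power2_eq_square)

text \<open>A zero of a nonnegative form is a minimum, so the gradient \<open>S *v x\<close> must
  vanish there; invertibility then forces \<open>x = 0\<close>. The gradient argument is made
  explicit by moving from \<open>x\<close> a distance \<open>t\<close> against
  \<open>y = S *v x\<close>.\<close>

lemma quad_form_pos:
  fixes S :: "real^'n^'n"
  assumes sym: "transpose S = S" and inv: "invertible S"
    and psd: "\<And>x. quad_form S x \<ge> 0" and "x \<noteq> 0"
  shows "quad_form S x > 0"
proof (rule ccontr)
  assume "\<not> quad_form S x > 0"
  with psd[of x] have q0: "quad_form S x = 0" by simp
  define y where "y = S *v x"
  define a where "a = y \<bullet> y"
  define b where "b = quad_form S y"
  have b: "b \<ge> 0" using psd by (simp add: b_def)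
  have *: "quad_form S (x + (- t) *\<^sub>R y) = - 2 * t * a + t\<^sup>2 * b" for t
    using quad_form_add[OF sym, of x "(- t) *\<^sub>R y"] q0
    by (simp add: quad_form_scaleR[of S "- t"] y_def a_def b_def del: scaleR_minus_left)
  \<comment> \<open>The minimiser of \<open>- 2 * t * a + t\<^sup>2 * (b + 1)\<close>; the added 1
    keeps the denominator positive when \<open>b = 0\<close>.\<close>
  define t where "t = a / (b + 1)"
  have "0 \<le> - 2 * t * a + t\<^sup>2 * b" using psd[of "x + (- t) *\<^sub>R y"] * by simp
  also have "\<dots> \<le> - 2 * t * a + t\<^sup>2 * (b + 1)" by (simp add: mult_left_mono)
  also have "\<dots> = - (a\<^sup>2 / (b + 1))"
  proof -
    have "t\<^sup>2 * (b + 1) = t * a" using b by (simp add: t_def power2_eq_square)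
    moreover have "t * a = a\<^sup>2 / (b + 1)" by (simp add: t_def power2_eq_square)
    ultimately show ?thesis by simp
  qed
  finally have "a\<^sup>2 / (b + 1) \<le> 0" by simp
  hence "a = 0" using b by (simp add: divide_le_0_iff)
  hence "S *v x = 0" by (simp add: a_def y_def)
  hence "x = 0" using inv matrix_left_invertible_ker[of S] by (metis invertible_left_inverse)
  with \<open>x \<noteq> 0\<close> show False by simp
qed

text \<open>Semidefiniteness together with invertibility is the form in which a non-singular
  covariance matrix arrives; definiteness follows by \<open>quad_form_pos\<close>.\<close>

locale spd_matrix =
  fixes S :: "real^'n^'n"
  assumes sym: "transpose S = S" and inv: "invertible S"
    and psd: "\<And>x. quad_form S x \<ge> 0"
begin

text \<open>The normalising denominator of \<open>inv_weights\<close> is the quadratic form of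
  \<open>S\<close> at \<open>matrix_inv S *v vec 1\<close>, a nonzero vector.\<close>

lemma total_weight_pos: "vec 1 \<bullet> (matrix_inv S *v vec 1) > 0"
proof -
  let ?u = "matrix_inv S *v vec 1"
  have u: "S *v ?u = vec 1" by (rule matrix_vector_mult_matrix_inv[OF inv])
  have "vec 1 \<noteq> (0::real^'n)" by (simp add: vec_eq_iff)
  hence "?u \<noteq> 0" using u by (metis matrix_vector_mult_0_right)
  from quad_form_pos[OF sym inv psd this] show ?thesis
    unfolding quad_form_def u by (simp add: inner_commute)
qed

lemma inv_weights_mem: "inv_weights S \<in> weight_set"
  using total_weight_pos by (intro inv_weights_in_weight_set) simp

text \<open>The gradient of the quadratic form at \<open>inv_weights S\<close> is proportional to \<open>vec 1\<close>, so the
  cross term of \<open>quad_form_add\<close> vanishes along \<open>weight_set\<close>.\<close>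

lemma quad_form_weight:
  assumes "w \<in> weight_set"
  shows "quad_form S w = quad_form S (inv_weights S) + quad_form S (w - inv_weights S)"
proof -
  let ?v = "inv_weights S" and ?c = "1 / (vec 1 \<bullet> (matrix_inv S *v vec 1))"
  have Sv: "S *v ?v = ?c *\<^sub>R vec 1"
    by (simp add: inv_weights_def matrix_vector_mult_scaleR matrix_vector_mult_matrix_inv[OF inv])
  have "vec 1 \<bullet> (w - ?v) = 0"
    using assms inv_weights_mem by (simp add: weight_set_iff inner_diff_right)
  hence "(w - ?v) \<bullet> (S *v ?v) = 0" by (simp add: Sv inner_commute)
  with quad_form_add[OF sym, of ?v "w - ?v"] show ?thesis by simp
qed

text \<open>By the Pythagorean identity \<open>quad_form_weight\<close>, the excess over the minimum
  is the form evaluated at the difference; semidefiniteness gives minimality and definiteness gives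
  uniqueness.\<close>

lemma is_arg_min_iff:
  "is_arg_min (quad_form S) (\<lambda>u. u \<in> weight_set) w \<longleftrightarrow> w = inv_weights S"
proof
  assume *: "is_arg_min (quad_form S) (\<lambda>u. u \<in> weight_set) w"
  hence "quad_form S w \<le> quad_form S (inv_weights S)"
    using inv_weights_mem by (auto simp: is_arg_min_def not_less)
  with quad_form_weight[of w] * have "quad_form S (w - inv_weights S) \<le> 0"
    by (simp add: is_arg_min_def)
  with quad_form_pos[OF sym inv psd, of "w - inv_weights S"] show "w = inv_weights S" by force
next
  assume w: "w = inv_weights S"
  have "quad_form S w \<le> quad_form S u" if "u \<in> weight_set" for u
    using quad_form_weight[OF that] psd[of "u - inv_weights S"] unfolding w by linarith
  with inv_weights_mem w show "is_arg_min (quad_form S) (\<lambda>u. u \<in> weight_set) w"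
    by (auto simp: is_arg_min_def not_less)
qed

text \<open>Putting all weight on one estimator is admissible: unit vectors lie in
  \<open>weight_set\<close>, and the form at \<open>axis j 1\<close> is the diagonal entry.\<close>

lemma quad_form_inv_weights_le: "quad_form S (inv_weights S) \<le> S $ j $ j"
proof -
  have "axis j 1 \<in> (weight_set :: (real^'n) set)"
    by (simp add: weight_set_iff inner_axis)
  from quad_form_weight[OF this] psd[of "axis j 1 - inv_weights S"] show ?thesis
    unfolding quad_form_axis by linarith
qed

text \<open>Excludes the degenerate branch of \<open>normal_dist\<close>, so the central limit
  theorem can divide by the standard deviation.\<close>

lemma quad_form_inv_weights_pos: "quad_form S (inv_weights S) > 0"
proof (rule quad_form_pos[OF sym inv psd])
  show "inv_weights S \<noteq> 0"
    using inv_weights_mem by (auto simp: weight_set_iff)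
qed

end

section \<open>Independence and i.i.d. samples\<close>

lemma indep_rv_D:
  assumes "prob_space M" "indep_rv M S U T V"
  shows "U \<in> M \<rightarrow>\<^sub>M S" "V \<in> M \<rightarrow>\<^sub>M T"
    and "\<And>A B. A \<in> sets S \<Longrightarrow> B \<in> sets T \<Longrightarrow>
      measure M ((U -` A \<inter> space M) \<inter> (V -` B \<inter> space M))
        = measure M (U -` A \<inter> space M) * measure M (V -` B \<inter> space M)"
  using assms prob_space.indep_setD[OF assms(1)] unfolding indep_rv_def by blast+

text \<open>Rectangles determine a product measure, and on rectangles independence is the product
  formula. This turns conditioning on the auxiliary sample into integration over slices.\<close>

lemma indep_rv_distr_pair:
  assumes M: "prob_space M" and UV: "indep_rv M S U T V"
  shows "distr M (S \<Otimes>\<^sub>M T) (\<lambda>x. (U x, V x)) = distr M S U \<Otimes>\<^sub>M distr M T V"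
proof (rule sym, rule pair_measure_eqI)
  interpret prob_space M by fact
  note [measurable] = indep_rv_D(1,2)[OF M UV]
  show "sigma_finite_measure (distr M S U)" "sigma_finite_measure (distr M T V)"
    by (intro prob_space_imp_sigma_finite prob_space_distr; measurable)+
  show "sets (distr M S U \<Otimes>\<^sub>M distr M T V) = sets (distr M (S \<Otimes>\<^sub>M T) (\<lambda>x. (U x, V x)))"
    by simp
  fix A B assume "A \<in> sets (distr M S U)" "B \<in> sets (distr M T V)"
  hence [measurable]: "A \<in> sets S" "B \<in> sets T" by auto
  have "(\<lambda>x. (U x, V x)) -` (A \<times> B) \<inter> space M = (U -` A \<inter> space M) \<inter> (V -` B \<inter> space M)" by auto
  with indep_rv_D(3)[OF M UV, of A B]
  show "emeasure (distr M S U) A * emeasure (distr M T V) B =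
      emeasure (distr M (S \<Otimes>\<^sub>M T) (\<lambda>x. (U x, V x))) (A \<times> B)"
    by (simp add: emeasure_distr emeasure_eq_measure ennreal_mult')
qed

lemma indep_rv_compose:
  assumes M: "prob_space M" and UV: "indep_rv M S U T V"
    and g: "g \<in> S \<rightarrow>\<^sub>M S'" and h: "h \<in> T \<rightarrow>\<^sub>M T'"
  shows "indep_rv M S' (\<lambda>x. g (U x)) T' (\<lambda>x. h (V x))"
proof -
  interpret prob_space M by fact
  note [measurable] = indep_rv_D(1,2)[OF M UV] g h
  have vimage: "(\<lambda>x. g (U x)) -` A \<inter> space M = U -` (g -` A \<inter> space S) \<inter> space M" for A
    using measurable_space[OF indep_rv_D(1)[OF M UV]] by auto
  have vimage': "(\<lambda>x. h (V x)) -` B \<inter> space M = V -` (h -` B \<inter> space T) \<inter> space M" for B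
    using measurable_space[OF indep_rv_D(2)[OF M UV]] by auto
  have "prob ((\<lambda>x. g (U x)) -` A \<inter> space M \<inter> ((\<lambda>x. h (V x)) -` B \<inter> space M))
      = prob ((\<lambda>x. g (U x)) -` A \<inter> space M) * prob ((\<lambda>x. h (V x)) -` B \<inter> space M)"
    if "A \<in> sets S'" "B \<in> sets T'" for A B
    unfolding vimage vimage' using that
    by (intro indep_rv_D(3)[OF M UV] measurable_sets[OF g] measurable_sets[OF h])
  moreover have "(\<lambda>x. g (U x)) \<in> M \<rightarrow>\<^sub>M S'" "(\<lambda>x. h (V x)) \<in> M \<rightarrow>\<^sub>M T'"
    by measurable
  ultimately show ?thesis
    unfolding indep_rv_def indep_sets2_eq by (blast dest: measurable_sets)
qed

text \<open>Composition with \<open>g\<close> and \<open>h\<close> brings both variables into the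
  reals, where \<open>indep_var\<close> and its product rule for expectations apply.\<close>

lemma indep_rv_integral_mult:
  fixes g :: "'a \<Rightarrow> real" and h :: "'b \<Rightarrow> real"
  assumes M: "prob_space M" and UV: "indep_rv M S U T V"
    and g: "g \<in> borel_measurable S" "integrable M (\<lambda>x. g (U x))"
    and h: "h \<in> borel_measurable T" "integrable M (\<lambda>x. h (V x))"
  shows "(\<integral>x. g (U x) * h (V x) \<partial>M) = (\<integral>x. g (U x) \<partial>M) * (\<integral>x. h (V x) \<partial>M)"
    and "integrable M (\<lambda>x. g (U x) * h (V x))"
proof -
  interpret prob_space M by fact
  have "indep_rv M borel (\<lambda>x. g (U x)) borel (\<lambda>x. h (V x))"
    by (rule indep_rv_compose[OF M UV g(1) h(1)])
  hence "indep_var borel (\<lambda>x. g (U x)) borel (\<lambda>x. h (V x))"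
    using indep_rv_distr_pair[OF M, symmetric] indep_rv_D(1,2)[OF M]
    by (subst indep_var_distribution_eq) blast
  from indep_var_lebesgue_integral[OF this] indep_var_integrable[OF this] g h
  show "(\<integral>x. g (U x) * h (V x) \<partial>M) = (\<integral>x. g (U x) \<partial>M) * (\<integral>x. h (V x) \<partial>M)"
    and "integrable M (\<lambda>x. g (U x) * h (V x))"
    by auto
qed

section \<open>Moments, tails and characteristic functions of i.i.d. sums\<close>

locale iid_sample = prob_space M
  for M :: "'w measure" and E :: "'e measure" and D :: "'i \<Rightarrow> 'w \<Rightarrow> 'e" and I :: "'i set"
    and Q :: "'e measure" +
  assumes indep: "indep_vars (\<lambda>_. E) D I"
    and law: "\<And>i. i \<in> I \<Longrightarrow> distr M E (D i) = Q"
begin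

lemma measurable_sample: "i \<in> I \<Longrightarrow> D i \<in> M \<rightarrow>\<^sub>M E"
  using indep unfolding indep_vars_def2 by auto

lemma sets_law: "i \<in> I \<Longrightarrow> sets Q = sets E"
  using law by force

lemma integral_sample:
  fixes g :: "'e \<Rightarrow> real"
  assumes "i \<in> I" "g \<in> borel_measurable E"
  shows "(\<integral>\<omega>. g (D i \<omega>) \<partial>M) = (\<integral>z. g z \<partial>Q)"
    and "integrable M (\<lambda>\<omega>. g (D i \<omega>)) \<longleftrightarrow> integrable Q g"
  unfolding law[OF assms(1), symmetric]
  by (rule integral_distr[OF measurable_sample[OF assms(1)] assms(2), symmetric],
      rule integrable_distr_eq[OF measurable_sample[OF assms(1)] assms(2), symmetric])

text \<open>In the expanded square the off-diagonal terms vanish: independence factors each of them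
  into a product of means, which are zero.\<close>

lemma second_moment_sum:
  fixes g :: "'e \<Rightarrow> real"
  assumes I: "finite I" and g [measurable]: "g \<in> borel_measurable E"
    and sq: "integrable Q (\<lambda>z. (g z)\<^sup>2)" and mean: "(\<integral>z. g z \<partial>Q) = 0"
  shows "integrable M (\<lambda>\<omega>. (\<Sum>i\<in>I. g (D i \<omega>))\<^sup>2)"
    and "(\<integral>\<omega>. (\<Sum>i\<in>I. g (D i \<omega>))\<^sup>2 \<partial>M) = card I * (\<integral>z. (g z)\<^sup>2 \<partial>Q)"
proof -
  have sqi: "integrable M (\<lambda>\<omega>. (g (D i \<omega>))\<^sup>2)" if "i \<in> I" for i
    using integral_sample(2)[OF that, of "\<lambda>z. (g z)\<^sup>2"] sq by simp
  have int: "integrable M (\<lambda>\<omega>. g (D i \<omega>))" if "i \<in> I" for i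
    by (rule square_integrable_imp_integrable[OF measurable_compose[OF measurable_sample[OF that] g] sqi[OF that]])
  have prod: "integrable M (\<lambda>\<omega>. g (D i \<omega>) * g (D j \<omega>))
      \<and> (\<integral>\<omega>. g (D i \<omega>) * g (D j \<omega>) \<partial>M) = (if i = j then \<integral>z. (g z)\<^sup>2 \<partial>Q else 0)"
    if "i \<in> I" "j \<in> I" for i j
  proof (cases "i = j")
    case True
    have "(\<integral>\<omega>. (g (D i \<omega>))\<^sup>2 \<partial>M) = (\<integral>z. (g z)\<^sup>2 \<partial>Q)"
      by (rule integral_sample(1)[OF that(1)]) simp
    with sqi[OF that(1)] show ?thesis
      unfolding True[symmetric] power2_eq_square by simp
  next
    case False
    have "indep_vars (\<lambda>_. borel) (\<lambda>k \<omega>. g (D k \<omega>)) {i, j}"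
      using that by (intro indep_vars_compose2[OF indep_vars_subset[OF indep]]) auto
    moreover have "integrable M (\<lambda>\<omega>. g (D k \<omega>))" if "k \<in> {i, j}" for k
      using int that \<open>i \<in> I\<close> \<open>j \<in> I\<close> by auto
    ultimately show ?thesis
      using indep_vars_lebesgue_integral[of "{i, j}" "\<lambda>k \<omega>. g (D k \<omega>)"]
        indep_vars_integrable[of "{i, j}" "\<lambda>k \<omega>. g (D k \<omega>)"]
        that False integral_sample(1)[of i g] mean
      by simp
  qed
  have sq_eq: "(\<Sum>i\<in>I. g (D i \<omega>))\<^sup>2 = (\<Sum>i\<in>I. \<Sum>j\<in>I. g (D i \<omega>) * g (D j \<omega>))" for \<omega>
    unfolding power2_eq_square by (rule sum_product)
  show "integrable M (\<lambda>\<omega>. (\<Sum>i\<in>I. g (D i \<omega>))\<^sup>2)"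
    unfolding sq_eq using prod by (intro Bochner_Integration.integrable_sum) auto
  have "(\<integral>\<omega>. (\<Sum>i\<in>I. g (D i \<omega>))\<^sup>2 \<partial>M)
      = (\<Sum>i\<in>I. \<Sum>j\<in>I. \<integral>\<omega>. g (D i \<omega>) * g (D j \<omega>) \<partial>M)"
    unfolding sq_eq using prod by (simp add: integral_sum)
  also have "\<dots> = (\<Sum>i\<in>I. \<Sum>j\<in>I. if i = j then \<integral>z. (g z)\<^sup>2 \<partial>Q else 0)"
    using prod by (intro sum.cong) auto
  also have "\<dots> = card I * (\<integral>z. (g z)\<^sup>2 \<partial>Q)"
    using I by simp
  finally show "(\<integral>\<omega>. (\<Sum>i\<in>I. g (D i \<omega>))\<^sup>2 \<partial>M) = card I * (\<integral>z. (g z)\<^sup>2 \<partial>Q)" .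
qed

lemma tail_sum:
  fixes g :: "'e \<Rightarrow> real"
  assumes I: "finite I" and g [measurable]: "g \<in> borel_measurable E"
    and sq: "integrable Q (\<lambda>z. (g z)\<^sup>2)" and mean: "(\<integral>z. g z \<partial>Q) = 0" and "a > 0"
  shows "prob {\<omega> \<in> space M. a < \<bar>(\<Sum>i\<in>I. g (D i \<omega>)) / sqrt (card I)\<bar>} \<le> (\<integral>z. (g z)\<^sup>2 \<partial>Q) / a\<^sup>2"
proof (cases "I = {}")
  \<comment> \<open>This covers sample size zero: the empty sum divided by \<open>sqrt 0\<close> is
    0, so the event is empty.\<close>
  case True
  thus ?thesis using \<open>a > 0\<close> by (simp add: integral_nonneg_AE)
next
  case False
  with I have n: "card I > 0" by (simp add: card_gt_0_iff)
  let ?S = "\<lambda>\<omega>. \<Sum>i\<in>I. g (D i \<omega>)"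
  note [measurable] = measurable_sample
  have "{\<omega> \<in> space M. a < \<bar>?S \<omega> / sqrt (card I)\<bar>} \<subseteq> {\<omega> \<in> space M. a\<^sup>2 * card I \<le> (?S \<omega>)\<^sup>2}"
  proof safe
    fix \<omega> assume "a < \<bar>?S \<omega> / sqrt (card I)\<bar>"
    hence "a * sqrt (card I) < \<bar>?S \<omega>\<bar>" using n by (simp add: abs_divide pos_less_divide_eq)
    hence "(a * sqrt (card I))\<^sup>2 \<le> \<bar>?S \<omega>\<bar>\<^sup>2" using \<open>a > 0\<close> by (intro power_mono) auto
    thus "a\<^sup>2 * card I \<le> (?S \<omega>)\<^sup>2" by (simp add: power_mult_distrib)
  qed
  hence "prob {\<omega> \<in> space M. a < \<bar>?S \<omega> / sqrt (card I)\<bar>} \<le> prob {\<omega> \<in> space M. a\<^sup>2 * card I \<le> (?S \<omega>)\<^sup>2}"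
    by (intro finite_measure_mono) auto
  also have "\<dots> \<le> (\<integral>\<omega>. (?S \<omega>)\<^sup>2 \<partial>M) / (a\<^sup>2 * card I)"
    using second_moment_sum(1)[OF I g sq mean] n \<open>a > 0\<close>
    by (intro integral_Markov_inequality_measure[where A="{}"]) auto
  also have "\<dots> = (\<integral>z. (g z)\<^sup>2 \<partial>Q) / a\<^sup>2"
    using second_moment_sum(2)[OF I g sq mean] n by simp
  finally show ?thesis .
qed

text \<open>The right-hand side mentions neither the probability space nor the variables, only
  \<open>Q\<close> and the number of terms. This is what makes rows on different spaces
  comparable.\<close>

lemma char_sum:
  fixes g :: "'e \<Rightarrow> real"
  assumes g [measurable]: "g \<in> borel_measurable E"
  shows "char (distr M borel (\<lambda>\<omega>. (\<Sum>i\<in>I. g (D i \<omega>)) / c)) t = char (distr Q borel g) (t / c) ^ card I"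
proof -
  note [measurable] = measurable_sample
  have "indep_vars (\<lambda>_. borel) (\<lambda>i \<omega>. g (D i \<omega>) / c) I"
    by (rule indep_vars_compose2[OF indep, where Y="\<lambda>_ z. g z / c"]) simp
  from char_distr_sum[OF this, of t]
  have "char (distr M borel (\<lambda>\<omega>. (\<Sum>i\<in>I. g (D i \<omega>)) / c)) t
      = (\<Prod>i\<in>I. char (distr M borel (\<lambda>\<omega>. g (D i \<omega>) / c)) t)"
    by (simp add: sum_divide_distrib)
  also have "\<dots> = (\<Prod>i\<in>I. char (distr Q borel g) (t / c))"
  proof (rule prod.cong)
    fix i assume i: "i \<in> I"
    hence [measurable]: "D i \<in> M \<rightarrow>\<^sub>M E" "g \<in> borel_measurable Q"
      using measurable_sample sets_law[OF i] by (auto cong: measurable_cong_sets)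
    show "char (distr M borel (\<lambda>\<omega>. g (D i \<omega>) / c)) t = char (distr Q borel g) (t / c)"
      unfolding char_def by (subst law[OF i, symmetric]) (simp add: integral_distr distr_distr o_def)
  qed simp
  finally show ?thesis by simp
qed

end

text \<open>Chebyshev's inequality conditionally on \<open>T\<close>: the joint law of auxiliary
  sample and data is a product, so \<open>T\<close> can be frozen at \<open>t\<close>, after which
  the summands are i.i.d. with a fixed function \<open>U t\<close>. The moment conditions are
  required only for those \<open>t\<close> whose error \<open>e t\<close> is at most
  \<open>\<delta>\<close>; the remaining \<open>t\<close> contribute at most their
  probability.\<close>

lemma (in iid_sample) conditional_tail_sum:
  fixes U :: "'t \<Rightarrow> 'e \<Rightarrow> real" and e :: "'t \<Rightarrow> ennreal"
  assumes I: "finite I"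
    and T: "indep_rv M N T (PiM I (\<lambda>_. E)) (\<lambda>\<omega>. \<lambda>i\<in>I. D i \<omega>)"
    and U [measurable]: "(\<lambda>(t, z). U t z) \<in> borel_measurable (N \<Otimes>\<^sub>M E)"
    and e [measurable]: "e \<in> borel_measurable N"
    and sq: "\<And>t. t \<in> space N \<Longrightarrow> e t \<le> \<delta> \<Longrightarrow> integrable Q (\<lambda>z. (U t z)\<^sup>2)"
    and mean: "\<And>t. t \<in> space N \<Longrightarrow> e t \<le> \<delta> \<Longrightarrow> (\<integral>z. U t z \<partial>Q) = 0"
    and bound: "\<And>t. t \<in> space N \<Longrightarrow> e t \<le> \<delta> \<Longrightarrow> (\<integral>z. (U t z)\<^sup>2 \<partial>Q) \<le> K"
    and "a > 0" "K \<ge> 0"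
  shows "prob {\<omega> \<in> space M. a < \<bar>(\<Sum>i\<in>I. U (T \<omega>) (D i \<omega>)) / sqrt (card I)\<bar>}
    \<le> prob {\<omega> \<in> space M. \<delta> < e (T \<omega>)} + K / a\<^sup>2"
proof -
  let ?P = "PiM I (\<lambda>_. E)" and ?D = "\<lambda>\<omega>. \<lambda>i\<in>I. D i \<omega>"
  define R where "R = distr M ?P ?D"
  note [measurable] = indep_rv_D(1,2)[OF prob_space_axioms T]
  define F where "F t d = (\<Sum>i\<in>I. U t (d i)) / sqrt (card I)" for t d
  have Ui: "(\<lambda>p. U (fst p) (snd p i)) \<in> borel_measurable (N \<Otimes>\<^sub>M ?P)" if "i \<in> I" for i
  proof -
    have "(\<lambda>p. (fst p, snd p i)) \<in> N \<Otimes>\<^sub>M ?P \<rightarrow>\<^sub>M N \<Otimes>\<^sub>M E"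
      using that by measurable
    from measurable_compose[OF this U] show ?thesis by simp
  qed
  have F [measurable]: "(\<lambda>p. F (fst p) (snd p)) \<in> borel_measurable (N \<Otimes>\<^sub>M ?P)"
    unfolding F_def by (intro borel_measurable_divide borel_measurable_sum Ui) auto
  define B where "B = {p \<in> space (N \<Otimes>\<^sub>M ?P). a < \<bar>F (fst p) (snd p)\<bar>}"
  have B [measurable]: "B \<in> sets (N \<Otimes>\<^sub>M ?P)"
    unfolding B_def by measurable
  interpret R: prob_space R unfolding R_def by (intro prob_space_distr) measurable
  have F_D: "F t (?D \<omega>) = (\<Sum>i\<in>I. U t (D i \<omega>)) / sqrt (card I)" for t \<omega>
    unfolding F_def by (intro arg_cong2[where f="(/)"] sum.cong) auto
  have Tsp: "T \<omega> \<in> space N" "?D \<omega> \<in> space ?P" if "\<omega> \<in> space M" for \<omega>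
    using that measurable_space[OF indep_rv_D(1)[OF prob_space_axioms T]]
      measurable_space[OF indep_rv_D(2)[OF prob_space_axioms T]] by auto
  \<comment> \<open>For a good \<open>t\<close> the slice is a tail event of an i.i.d. sum; for a
    bad one the trivial bound 1 is absorbed by the indicator.\<close>
  have slice: "emeasure R (Pair t -` B) \<le> indicator {t \<in> space N. \<delta> < e t} t + ennreal (K / a\<^sup>2)"
    if t: "t \<in> space N" for t
  proof (cases "e t \<le> \<delta>")
    case True
    have Ut: "U t \<in> borel_measurable E"
      using measurable_compose[OF measurable_Pair1'[OF t] U] by simp
    have "emeasure R (Pair t -` B) = emeasure M (?D -` (Pair t -` B) \<inter> space M)"
      unfolding R_def using sets_Pair1[OF B] by (intro emeasure_distr) auto
    also have "?D -` (Pair t -` B) \<inter> space M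
        = {\<omega> \<in> space M. a < \<bar>(\<Sum>i\<in>I. U t (D i \<omega>)) / sqrt (card I)\<bar>}"
      using t Tsp(2) by (auto simp: B_def F_D space_pair_measure simp del: restrict_apply)
    also have "emeasure M \<dots> \<le> ennreal (K / a\<^sup>2)"
      unfolding emeasure_eq_measure
      by (intro ennreal_leI order.trans[OF tail_sum[OF I Ut sq[OF t True] mean[OF t True] \<open>a > 0\<close>]]
            divide_right_mono bound[OF t True]) auto
    finally show ?thesis by (simp add: add_increasing)
  next
    case False
    thus ?thesis using t R.emeasure_le_1[of "Pair t -` B"]
      by (simp add: not_le add_increasing2)
  qed
  have "emeasure M {\<omega> \<in> space M. a < \<bar>(\<Sum>i\<in>I. U (T \<omega>) (D i \<omega>)) / sqrt (card I)\<bar>}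
      = emeasure M ((\<lambda>\<omega>. (T \<omega>, ?D \<omega>)) -` B \<inter> space M)"
    using Tsp by (intro arg_cong[where f="emeasure M"])
      (auto simp: B_def F_D space_pair_measure simp del: restrict_apply)
  also have "\<dots> = emeasure (distr M (N \<Otimes>\<^sub>M ?P) (\<lambda>\<omega>. (T \<omega>, ?D \<omega>))) B"
    by (rule emeasure_distr[symmetric]) auto
  \<comment> \<open>Independence of \<open>T\<close> from the whole data vector enters here.\<close>
  also have "\<dots> = emeasure (distr M N T \<Otimes>\<^sub>M R) B"
    unfolding R_def indep_rv_distr_pair[OF prob_space_axioms T] ..
  also have "\<dots> = (\<integral>\<^sup>+t. emeasure R (Pair t -` B) \<partial>distr M N T)"
    by (rule R.emeasure_pair_measure_alt) (simp add: R_def)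
  also have "\<dots> \<le> (\<integral>\<^sup>+t. indicator {t \<in> space N. \<delta> < e t} t + ennreal (K / a\<^sup>2) \<partial>distr M N T)"
    by (intro nn_integral_mono slice) simp
  also have "\<dots> = emeasure (distr M N T) {t \<in> space N. \<delta> < e t}
      + ennreal (K / a\<^sup>2) * emeasure (distr M N T) (space N)"
    by (subst nn_integral_add) auto
  also have "\<dots> = emeasure M {\<omega> \<in> space M. \<delta> < e (T \<omega>)} + ennreal (K / a\<^sup>2)"
  proof -
    have "T -` {t \<in> space N. \<delta> < e t} \<inter> space M = {\<omega> \<in> space M. \<delta> < e (T \<omega>)}"
      and "T -` space N \<inter> space M = space M"
      using Tsp by auto
    thus ?thesis by (simp add: emeasure_distr emeasure_space_1)
  qed
  finally show ?thesis
    using \<open>K \<ge> 0\<close> by (simp add: emeasure_eq_measure flip: ennreal_plus)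
qed

section \<open>The central limit theorem as a limit of powers of one characteristic function\<close>

lemma indep_vars_PiM_coordinates:
  assumes "prob_space \<mu>" "sets \<mu> = sets E" "I \<noteq> {}"
  shows "prob_space.indep_vars (PiM I (\<lambda>_. \<mu>)) (\<lambda>_. E) (\<lambda>i x. x i) I"
proof -
  interpret prob_space "PiM I (\<lambda>_. \<mu>)" by (intro prob_space_PiM assms)
  have sets: "sets (PiM I (\<lambda>_. E)) = sets (PiM I (\<lambda>_. \<mu>))"
    by (intro sets_PiM_cong) (simp_all add: assms)
  have rv: "(\<lambda>x. x i) \<in> PiM I (\<lambda>_. \<mu>) \<rightarrow>\<^sub>M E" if "i \<in> I" for i
    using measurable_component_singleton[OF that, of "\<lambda>_. \<mu>"] assms(2)
    by (simp cong: measurable_cong_sets)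
  have "distr (PiM I (\<lambda>_. \<mu>)) (PiM I (\<lambda>_. E)) (\<lambda>x. \<lambda>i\<in>I. x i)
      = distr (PiM I (\<lambda>_. \<mu>)) (PiM I (\<lambda>_. \<mu>)) (\<lambda>x. x)"
    using sets by (intro distr_cong) (auto simp: space_PiM PiE_restrict)
  also have "\<dots> = PiM I (\<lambda>_. \<mu>)" by simp
  also have "\<dots> = PiM I (\<lambda>i. distr (PiM I (\<lambda>_. \<mu>)) E (\<lambda>x. x i))"
  proof (rule PiM_cong)
    fix i assume "i \<in> I"
    thus "\<mu> = distr (PiM I (\<lambda>_. \<mu>)) E (\<lambda>x. x i)"
      using distr_PiM_component[of I "\<lambda>_. \<mu>" i] assms by (simp cong: distr_cong)
  qed simp
  finally show ?thesis
    using assms rv by (subst indep_vars_iff_distr_eq_PiM') auto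
qed

lemma normal_dist_eq_distr:
  assumes "v > 0"
  shows "normal_dist 0 v = distr std_normal_distribution borel (\<lambda>x. sqrt v * x)"
proof -
  interpret prob_space std_normal_distribution by (rule prob_space_normal_density) simp
  have "distributed std_normal_distribution lborel (\<lambda>x. x) std_normal_density"
    by (auto simp: distributed_def distr_id2)
  from normal_density_affine[OF this, of "sqrt v" 0] assms
  have "distributed std_normal_distribution lborel (\<lambda>x. sqrt v * x) (normal_density 0 (sqrt v))"
    by simp
  hence "distr std_normal_distribution lborel (\<lambda>x. sqrt v * x) = density lborel (normal_density 0 (sqrt v))"
    by (simp add: distributed_def)
  moreover have "distr std_normal_distribution lborel (\<lambda>x. sqrt v * x)
      = distr std_normal_distribution borel (\<lambda>x. sqrt v * x)"
    by (intro distr_cong) auto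
  ultimately show ?thesis using assms by (simp add: normal_dist_def)
qed

lemma real_distribution_normal_dist: "v > 0 \<Longrightarrow> real_distribution (normal_dist 0 v)"
  unfolding normal_dist_eq_distr
  by (intro prob_space.real_distribution_distr prob_space_normal_density) auto

lemma char_normal_dist:
  assumes "v > 0"
  shows "char (normal_dist 0 v) t = char std_normal_distribution (t * sqrt v)"
  unfolding normal_dist_eq_distr[OF assms] char_def by (simp add: integral_distr mult.assoc)

text \<open>An auxiliary i.i.d. sequence with the law of \<open>g\<close> is realised by the
  coordinates of an infinite product. The central limit theorem holds there, and its conclusion,
  read through characteristic functions, concerns only the law of \<open>g\<close>.\<close>

lemma char_power_tendsto_normal:
  fixes g :: "'e \<Rightarrow> real"
  assumes Q: "prob_space Q" and g [measurable]: "g \<in> borel_measurable Q"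
    and sq: "integrable Q (\<lambda>z. (g z)\<^sup>2)" and mean: "(\<integral>z. g z \<partial>Q) = 0"
    and v: "(\<integral>z. (g z)\<^sup>2 \<partial>Q) = v" "v > 0"
  shows "(\<lambda>n. char (distr Q borel g) (t / sqrt n) ^ n) \<longlonglongrightarrow> char (normal_dist 0 v) t"
proof -
  define \<mu> where "\<mu> = distr Q borel g"
  have \<mu>: "prob_space \<mu>" unfolding \<mu>_def by (intro prob_space.prob_space_distr Q g)
  define M where "M = PiM (UNIV :: nat set) (\<lambda>_. \<mu>)"
  interpret M: prob_space M unfolding M_def by (intro prob_space_PiM \<mu>)
  define X where "X = (\<lambda>(i::nat) (x::nat \<Rightarrow> real). x i)"
  have indep: "M.indep_vars (\<lambda>_. borel) X UNIV"
    unfolding M_def X_def by (rule indep_vars_PiM_coordinates[OF \<mu>]) (simp_all add: \<mu>_def)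
  have X [measurable]: "X i \<in> borel_measurable M" for i
    using indep by (simp add: M.indep_vars_def2)
  have law: "distr M borel (X i) = \<mu>" for i
    using distr_PiM_component[of UNIV "\<lambda>_. \<mu>" i] \<mu>
    by (simp add: M_def X_def \<mu>_def cong: distr_cong)
  have mean0: "(\<integral>x. X i x \<partial>M) = 0" for i
    using integral_distr[OF X, of "\<lambda>x. x" i] integral_distr[OF g, of "\<lambda>x. x"] mean
    by (simp add: law \<mu>_def)
  have sq_int: "integrable M (\<lambda>x. (X i x)\<^sup>2)" for i
    using integrable_distr_eq[OF X, of "\<lambda>x. x\<^sup>2" i] integrable_distr_eq[OF g, of "\<lambda>x. x\<^sup>2"] sq
    by (simp add: law \<mu>_def)
  have var: "(\<integral>x. (X i x)\<^sup>2 \<partial>M) = v" for i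
    using integral_distr[OF X, of "\<lambda>x. x\<^sup>2" i] integral_distr[OF g, of "\<lambda>x. x\<^sup>2"] v
    by (simp add: law \<mu>_def)
  have "weak_conv_m (\<lambda>n. distr M borel (\<lambda>x. (\<Sum>i<n. X i x) / sqrt (n * (sqrt v)\<^sup>2))) std_normal_distribution"
    by (rule M.central_limit_theorem_zero_mean[where \<mu>=\<mu>]) (use v in \<open>simp_all add: indep mean0 sq_int var law\<close>)
  \<comment> \<open>The argument \<open>t * sqrt v\<close> undoes the standardisation: dividing it
    by \<open>sqrt (n * v)\<close> leaves \<open>t / sqrt n\<close>.\<close>
  from levy_continuity1[OF M.real_distribution_distr real_dist_normal_dist this]
  have "(\<lambda>n. char (distr M borel (\<lambda>x. (\<Sum>i<n. X i x) / sqrt (n * (sqrt v)\<^sup>2))) (t * sqrt v))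
      \<longlonglongrightarrow> char (normal_dist 0 v) t"
    unfolding char_normal_dist[OF v(2)] by simp
  moreover have "char (distr M borel (\<lambda>x. (\<Sum>i<n. X i x) / sqrt (n * (sqrt v)\<^sup>2))) (t * sqrt v)
      = char (distr Q borel g) (t / sqrt n) ^ n" for n
  proof -
    interpret iid_sample M borel X "{..<n}" \<mu>
      by unfold_locales (auto intro: M.indep_vars_subset[OF indep] law)
    have "distr \<mu> borel (\<lambda>x. x) = \<mu>" by (rule distr_id2) (simp add: \<mu>_def)
    with char_sum[of "\<lambda>x. x" "sqrt (n * (sqrt v)\<^sup>2)" "t * sqrt v"] v(2) show ?thesis
      by (simp add: \<mu>_def real_sqrt_mult)
  qed
  ultimately show ?thesis by simp
qed

section \<open>Convergence in probability on varying spaces\<close>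

lemma norm_iexp_diff_le: "norm (iexp x - iexp y) \<le> \<bar>x - y\<bar>"
proof -
  have "iexp x - iexp y = iexp y * (iexp (x - y) - 1)"
    by (simp add: algebra_simps flip: exp_add)
  hence "norm (iexp x - iexp y) = norm (iexp (x - y) - 1)"
    by (simp add: norm_mult)
  also have "\<dots> \<le> \<bar>x - y\<bar>" using iexp_approx1[of "x - y" 0] by simp
  finally show ?thesis .
qed

locale prob_spaces =
  fixes \<Omega> :: "nat \<Rightarrow> 'w measure"
  assumes prob_spaces: "\<And>n. prob_space (\<Omega> n)"
begin

sublocale prob_space "\<Omega> n" for n by (rule prob_spaces)

text \<open>The bound is demanded only for large \<open>n\<close>, so that convergence to zero in
  probability implies it directly.\<close>

definition bounded_in_prob :: "(nat \<Rightarrow> 'w \<Rightarrow> real) \<Rightarrow> bool" where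
  "bounded_in_prob V \<longleftrightarrow>
     (\<forall>\<eta>>0. \<exists>K>0. eventually (\<lambda>n. measure (\<Omega> n) {\<omega> \<in> space (\<Omega> n). K < \<bar>V n \<omega>\<bar>} \<le> \<eta>) sequentially)"

lemma tendsto_in_prob_0_iff:
  fixes V :: "nat \<Rightarrow> 'w \<Rightarrow> real"
  shows "tendsto_in_prob \<Omega> V 0 \<longleftrightarrow>
    (\<forall>\<epsilon>>0. (\<lambda>n. measure (\<Omega> n) {\<omega> \<in> space (\<Omega> n). \<epsilon> < \<bar>V n \<omega>\<bar>}) \<longlonglongrightarrow> 0)"
  by (simp add: tendsto_in_prob_def dist_real_def)

lemma tendsto_in_prob_0_eventually:
  fixes V :: "nat \<Rightarrow> 'w \<Rightarrow> real"
  shows "tendsto_in_prob \<Omega> V 0 \<longleftrightarrow> (\<forall>\<epsilon>>0. \<forall>\<eta>>0.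
    eventually (\<lambda>n. measure (\<Omega> n) {\<omega> \<in> space (\<Omega> n). \<epsilon> < \<bar>V n \<omega>\<bar>} \<le> \<eta>) sequentially)"
    (is "_ \<longleftrightarrow> (\<forall>\<epsilon>>0. ?E \<epsilon>)")
proof -
  have "(\<lambda>n. measure (\<Omega> n) {\<omega> \<in> space (\<Omega> n). \<epsilon> < \<bar>V n \<omega>\<bar>}) \<longlonglongrightarrow> 0 \<longleftrightarrow> ?E \<epsilon>" for \<epsilon>
  proof
    assume lim: "(\<lambda>n. measure (\<Omega> n) {\<omega> \<in> space (\<Omega> n). \<epsilon> < \<bar>V n \<omega>\<bar>}) \<longlonglongrightarrow> 0"
    show "?E \<epsilon>"
      using order_tendstoD(2)[OF lim] by (blast intro: eventually_mono less_imp_le)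
  next
    assume E: "?E \<epsilon>"
    show "(\<lambda>n. measure (\<Omega> n) {\<omega> \<in> space (\<Omega> n). \<epsilon> < \<bar>V n \<omega>\<bar>}) \<longlonglongrightarrow> 0"
    proof (rule tendstoI)
      fix \<eta> :: real assume "\<eta> > 0"
      with E[rule_format, of "\<eta> / 2"]
      show "eventually (\<lambda>n. dist (measure (\<Omega> n) {\<omega> \<in> space (\<Omega> n). \<epsilon> < \<bar>V n \<omega>\<bar>}) 0 < \<eta>) sequentially"
        by (auto elim!: eventually_mono)
    qed
  qed
  thus ?thesis by (simp add: tendsto_in_prob_0_iff)
qed

lemma tendsto_in_prob_imp_bounded: "tendsto_in_prob \<Omega> V 0 \<Longrightarrow> bounded_in_prob V"
  unfolding tendsto_in_prob_0_eventually bounded_in_prob_def using zero_less_one by blast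

lemma bounded_in_prob_const: "bounded_in_prob (\<lambda>_ _. c)"
  unfolding bounded_in_prob_def
  by (intro allI impI exI[of _ "\<bar>c\<bar> + 1"] conjI always_eventually) simp_all

lemma tendsto_in_prob_add:
  fixes U V :: "nat \<Rightarrow> 'w \<Rightarrow> real"
  assumes [measurable]: "\<And>n. U n \<in> borel_measurable (\<Omega> n)" "\<And>n. V n \<in> borel_measurable (\<Omega> n)"
    and U: "tendsto_in_prob \<Omega> U 0" and V: "tendsto_in_prob \<Omega> V 0"
  shows "tendsto_in_prob \<Omega> (\<lambda>n \<omega>. U n \<omega> + V n \<omega>) 0"
  unfolding tendsto_in_prob_0_iff
proof (intro allI impI)
  fix \<epsilon> :: real assume "\<epsilon> > 0"
  define m where "m W n = measure (\<Omega> n) {\<omega> \<in> space (\<Omega> n). \<epsilon> / 2 < \<bar>W n \<omega>\<bar>}"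
    for W :: "nat \<Rightarrow> 'w \<Rightarrow> real" and n
  have le: "measure (\<Omega> n) {\<omega> \<in> space (\<Omega> n). \<epsilon> < \<bar>U n \<omega> + V n \<omega>\<bar>} \<le> m U n + m V n" for n
  proof -
    have "measure (\<Omega> n) {\<omega> \<in> space (\<Omega> n). \<epsilon> < \<bar>U n \<omega> + V n \<omega>\<bar>}
      \<le> measure (\<Omega> n) ({\<omega> \<in> space (\<Omega> n). \<epsilon> / 2 < \<bar>U n \<omega>\<bar>} \<union> {\<omega> \<in> space (\<Omega> n). \<epsilon> / 2 < \<bar>V n \<omega>\<bar>})"
      by (intro finite_measure_mono) auto
    also have "\<dots> \<le> m U n + m V n"
      unfolding m_def by (intro measure_Un_le) measurable
    finally show ?thesis .
  qed
  have "m U \<longlonglongrightarrow> 0" "m V \<longlonglongrightarrow> 0"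
    using U V half_gt_zero[OF \<open>\<epsilon> > 0\<close>] unfolding m_def tendsto_in_prob_0_iff by blast+
  hence "(\<lambda>n. m U n + m V n) \<longlonglongrightarrow> 0" by (auto intro: tendsto_eq_intros)
  thus "(\<lambda>n. measure (\<Omega> n) {\<omega> \<in> space (\<Omega> n). \<epsilon> < \<bar>U n \<omega> + V n \<omega>\<bar>}) \<longlonglongrightarrow> 0"
    by (rule tendsto_sandwich[OF _ _ tendsto_const, rotated 2]) (auto simp: le)
qed

lemma tendsto_in_prob_sum:
  fixes U :: "'i \<Rightarrow> nat \<Rightarrow> 'w \<Rightarrow> real"
  assumes "finite J" and "\<And>j n. U j n \<in> borel_measurable (\<Omega> n)"
    and "\<And>j. j \<in> J \<Longrightarrow> tendsto_in_prob \<Omega> (U j) 0"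
  shows "tendsto_in_prob \<Omega> (\<lambda>n \<omega>. \<Sum>j\<in>J. U j n \<omega>) 0"
  using assms(1,3)
proof (induction J rule: finite_induct)
  case empty
  thus ?case by (simp add: tendsto_in_prob_0_iff)
next
  case (insert j J)
  thus ?case using assms(2)
    by (simp add: tendsto_in_prob_add borel_measurable_sum)
qed

text \<open>A product can exceed \<open>\<epsilon>\<close> only if the second factor exceeds
  \<open>K\<close> or the first exceeds \<open>\<epsilon> / K\<close>. No independence of the
  factors is involved, which matters since weights and estimators share the data.\<close>

lemma tendsto_in_prob_mult:
  fixes U V :: "nat \<Rightarrow> 'w \<Rightarrow> real"
  assumes [measurable]: "\<And>n. U n \<in> borel_measurable (\<Omega> n)" "\<And>n. V n \<in> borel_measurable (\<Omega> n)"
    and U: "tendsto_in_prob \<Omega> U 0" and V: "bounded_in_prob V"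
  shows "tendsto_in_prob \<Omega> (\<lambda>n \<omega>. U n \<omega> * V n \<omega>) 0"
  unfolding tendsto_in_prob_0_eventually
proof (intro allI impI)
  fix \<epsilon> \<eta> :: real assume "\<epsilon> > 0" "\<eta> > 0"
  then obtain K where K: "K > 0"
    and KV: "eventually (\<lambda>n. measure (\<Omega> n) {\<omega> \<in> space (\<Omega> n). K < \<bar>V n \<omega>\<bar>} \<le> \<eta> / 2) sequentially"
    using V[unfolded bounded_in_prob_def, rule_format, of "\<eta> / 2"] by auto
  have KU: "eventually (\<lambda>n. measure (\<Omega> n) {\<omega> \<in> space (\<Omega> n). \<epsilon> / K < \<bar>U n \<omega>\<bar>} \<le> \<eta> / 2) sequentially"
    using U[unfolded tendsto_in_prob_0_eventually, rule_format, of "\<epsilon> / K" "\<eta> / 2"] \<open>\<epsilon> > 0\<close> \<open>\<eta> > 0\<close> K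
    by (simp del: le_divide_eq_numeral1)
  show "eventually (\<lambda>n. measure (\<Omega> n) {\<omega> \<in> space (\<Omega> n). \<epsilon> < \<bar>U n \<omega> * V n \<omega>\<bar>} \<le> \<eta>) sequentially"
    using KV KU
  proof eventually_elim
    case (elim n)
    have "{\<omega> \<in> space (\<Omega> n). \<epsilon> < \<bar>U n \<omega> * V n \<omega>\<bar>}
        \<subseteq> {\<omega> \<in> space (\<Omega> n). K < \<bar>V n \<omega>\<bar>} \<union> {\<omega> \<in> space (\<Omega> n). \<epsilon> / K < \<bar>U n \<omega>\<bar>}"
    proof (safe, rule ccontr)
      fix \<omega> assume *: "\<epsilon> < \<bar>U n \<omega> * V n \<omega>\<bar>" "\<not> K < \<bar>V n \<omega>\<bar>" "\<not> \<epsilon> / K < \<bar>U n \<omega>\<bar>"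
      hence "\<bar>U n \<omega>\<bar> * \<bar>V n \<omega>\<bar> \<le> (\<epsilon> / K) * K"
        using K \<open>\<epsilon> > 0\<close> by (intro mult_mono) auto
      with * K show False by (simp add: abs_mult)
    qed
    hence "measure (\<Omega> n) {\<omega> \<in> space (\<Omega> n). \<epsilon> < \<bar>U n \<omega> * V n \<omega>\<bar>} \<le>
      measure (\<Omega> n) ({\<omega> \<in> space (\<Omega> n). K < \<bar>V n \<omega>\<bar>} \<union> {\<omega> \<in> space (\<Omega> n). \<epsilon> / K < \<bar>U n \<omega>\<bar>})"
      by (intro finite_measure_mono) auto
    also have "\<dots> \<le> measure (\<Omega> n) {\<omega> \<in> space (\<Omega> n). K < \<bar>V n \<omega>\<bar>}
        + measure (\<Omega> n) {\<omega> \<in> space (\<Omega> n). \<epsilon> / K < \<bar>U n \<omega>\<bar>}"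
      by (intro measure_Un_le) measurable
    finally show ?case using elim by linarith
  qed
qed

text \<open>A continuous mapping principle in which \<open>V\<close> need not be a function of
  \<open>U\<close> and may depend on \<open>n\<close>: it suffices that \<open>V\<close> is small,
  uniformly in \<open>n\<close>, wherever \<open>U\<close> is close to \<open>c\<close>. This form
  accommodates weights that are unspecified away from the limit matrix.\<close>

lemma tendsto_in_prob_0_if_eventually_nhds:
  fixes V :: "nat \<Rightarrow> 'w \<Rightarrow> real" and U :: "nat \<Rightarrow> 'w \<Rightarrow> 'b::metric_space"
  assumes U: "tendsto_in_prob \<Omega> U c"
    and meas: "\<And>n. (\<lambda>\<omega>. dist (U n \<omega>) c) \<in> borel_measurable (\<Omega> n)"
    and ev: "\<And>\<epsilon>. \<epsilon> > 0 \<Longrightarrow> eventually (\<lambda>u. \<forall>n. \<forall>\<omega>\<in>space (\<Omega> n). U n \<omega> = u \<longrightarrow> \<bar>V n \<omega>\<bar> \<le> \<epsilon>) (nhds c)"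
  shows "tendsto_in_prob \<Omega> V 0"
  unfolding tendsto_in_prob_0_iff
proof (intro allI impI)
  fix \<epsilon> :: real assume "\<epsilon> > 0"
  from ev[OF this] obtain \<delta> where "\<delta> > 0"
    and \<delta>: "\<And>n \<omega>. \<omega> \<in> space (\<Omega> n) \<Longrightarrow> dist (U n \<omega>) c < \<delta> \<Longrightarrow> \<bar>V n \<omega>\<bar> \<le> \<epsilon>"
    unfolding eventually_nhds_metric by blast
  note [measurable] = meas
  \<comment> \<open>Halving \<open>\<delta>\<close> makes the complement,
    \<open>dist (U n \<omega>) c \<le> \<delta> / 2\<close>, lie inside the open ball.\<close>
  have le: "measure (\<Omega> n) {\<omega> \<in> space (\<Omega> n). \<epsilon> < \<bar>V n \<omega>\<bar>}
      \<le> measure (\<Omega> n) {\<omega> \<in> space (\<Omega> n). \<delta> / 2 < dist (U n \<omega>) c}" for n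
  proof (rule finite_measure_mono)
    show "{\<omega> \<in> space (\<Omega> n). \<epsilon> < \<bar>V n \<omega>\<bar>} \<subseteq> {\<omega> \<in> space (\<Omega> n). \<delta> / 2 < dist (U n \<omega>) c}"
      using \<delta>[of _ n] \<open>\<delta> > 0\<close> by force
  qed measurable
  have "(\<lambda>n. measure (\<Omega> n) {\<omega> \<in> space (\<Omega> n). \<delta> / 2 < dist (U n \<omega>) c}) \<longlonglongrightarrow> 0"
    using U half_gt_zero[OF \<open>\<delta> > 0\<close>] unfolding tendsto_in_prob_def by blast
  thus "(\<lambda>n. measure (\<Omega> n) {\<omega> \<in> space (\<Omega> n). \<epsilon> < \<bar>V n \<omega>\<bar>}) \<longlonglongrightarrow> 0"
    by (rule tendsto_sandwich[OF always_eventually always_eventually tendsto_const, rotated 2])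
       (use le in \<open>simp_all only: measure_nonneg simp_thms\<close>)
qed

text \<open>The map \<open>iexp\<close> is Lipschitz on the real line and bounded, so variables that
  are close in probability have close characteristic functions; Levy's continuity theorem converts
  this back to weak convergence.\<close>

lemma slutsky:
  fixes U V :: "nat \<Rightarrow> 'w \<Rightarrow> real"
  assumes U [measurable]: "\<And>n. U n \<in> borel_measurable (\<Omega> n)"
    and V [measurable]: "\<And>n. V n \<in> borel_measurable (\<Omega> n)"
    and L: "real_distribution L"
    and char: "\<And>t. (\<lambda>n. char (distr (\<Omega> n) borel (U n)) t) \<longlonglongrightarrow> char L t"
    and diff: "tendsto_in_prob \<Omega> (\<lambda>n \<omega>. V n \<omega> - U n \<omega>) 0"
  shows "weak_conv_m (\<lambda>n. distr (\<Omega> n) borel (V n)) L"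
proof (rule levy_continuity[OF _ L])
  show "real_distribution (distr (\<Omega> n) borel (V n))" for n
    by (intro real_distribution_distr) simp
  fix t
  define d where "d n = char (distr (\<Omega> n) borel (V n)) t - char (distr (\<Omega> n) borel (U n)) t" for n
  define m where "m \<epsilon> n = measure (\<Omega> n) {\<omega> \<in> space (\<Omega> n). \<epsilon> < \<bar>V n \<omega> - U n \<omega>\<bar>}" for \<epsilon> n
  \<comment> \<open>Off the event of a deviation above \<open>\<epsilon>\<close> the integrand is at
    most \<open>\<bar>t\<bar> * \<epsilon>\<close>; on that event it is at most 2, the diameter of
    the unit circle.\<close>
  have bound: "norm (d n) \<le> \<bar>t\<bar> * \<epsilon> + 2 * m \<epsilon> n" if "\<epsilon> > 0" for n \<epsilon>
  proof -
    let ?B = "{\<omega> \<in> space (\<Omega> n). \<epsilon> < \<bar>V n \<omega> - U n \<omega>\<bar>}"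
    have intV: "complex_integrable (\<Omega> n) (\<lambda>\<omega>. iexp (t * V n \<omega>))"
      and intU: "complex_integrable (\<Omega> n) (\<lambda>\<omega>. iexp (t * U n \<omega>))"
      by (intro integrable_iexp; simp)+
    have intB: "integrable (\<Omega> n) (\<lambda>\<omega>. \<bar>t\<bar> * \<epsilon> + 2 * indicator ?B \<omega>)"
      by (intro Bochner_Integration.integrable_add integrable_mult_right integrable_real_indicator)
         (auto simp: emeasure_eq_measure)
    have "d n = (CLINT \<omega>|\<Omega> n. iexp (t * V n \<omega>) - iexp (t * U n \<omega>))"
      unfolding d_def char_def using intU intV by (simp add: integral_distr)
    also have "norm \<dots> \<le> (LINT \<omega>|\<Omega> n. norm (iexp (t * V n \<omega>) - iexp (t * U n \<omega>)))"
      by (rule integral_norm_bound)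
    also have "\<dots> \<le> (LINT \<omega>|\<Omega> n. \<bar>t\<bar> * \<epsilon> + 2 * indicator ?B \<omega>)"
    proof (rule integral_mono[OF _ intB])
      show "integrable (\<Omega> n) (\<lambda>\<omega>. norm (iexp (t * V n \<omega>) - iexp (t * U n \<omega>)))"
        using intU intV by (intro integrable_norm Bochner_Integration.integrable_diff)
      fix \<omega> assume \<omega>: "\<omega> \<in> space (\<Omega> n)"
      show "norm (iexp (t * V n \<omega>) - iexp (t * U n \<omega>)) \<le> \<bar>t\<bar> * \<epsilon> + 2 * indicator ?B \<omega>"
      proof (cases "\<omega> \<in> ?B")
        case True
        have "norm (iexp (t * V n \<omega>) - iexp (t * U n \<omega>)) \<le> 2"
          using norm_triangle_ineq4[of "iexp (t * V n \<omega>)" "iexp (t * U n \<omega>)"] by simp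
        thus ?thesis using True \<open>\<epsilon> > 0\<close> by (simp add: add_increasing)
      next
        case False
        have "norm (iexp (t * V n \<omega>) - iexp (t * U n \<omega>)) \<le> \<bar>t * V n \<omega> - t * U n \<omega>\<bar>"
          by (rule norm_iexp_diff_le)
        also have "\<dots> = \<bar>t\<bar> * \<bar>V n \<omega> - U n \<omega>\<bar>"
          by (simp add: abs_mult right_diff_distrib flip: abs_mult)
        also have "\<dots> \<le> \<bar>t\<bar> * \<epsilon>" using False \<omega> by (intro mult_left_mono) auto
        finally show ?thesis using False by simp
      qed
    qed
    also have "\<dots> = \<bar>t\<bar> * \<epsilon> + 2 * m \<epsilon> n"
      unfolding m_def by (subst Bochner_Integration.integral_add)
        (auto intro!: integrable_real_indicator simp: prob_space emeasure_eq_measure)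
    finally show ?thesis .
  qed
  have "d \<longlonglongrightarrow> 0"
  proof (rule tendstoI)
    fix \<eta> :: real assume "\<eta> > 0"
    \<comment> \<open>Gives the first summand of the bound half of \<open>\<eta>\<close>; adding 1
      to \<open>\<bar>t\<bar>\<close> covers \<open>t = 0\<close>.\<close>
    define \<epsilon> where "\<epsilon> = \<eta> / (2 * (\<bar>t\<bar> + 1))"
    have \<epsilon>: "\<epsilon> > 0" "\<bar>t\<bar> * \<epsilon> \<le> \<eta> / 2"
      using \<open>\<eta> > 0\<close> by (auto simp: \<epsilon>_def field_simps)
    have "m \<epsilon> \<longlonglongrightarrow> 0"
      using diff \<epsilon>(1) unfolding m_def tendsto_in_prob_0_iff by blast
    hence "eventually (\<lambda>n. m \<epsilon> n < \<eta> / 4) sequentially"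
      using \<open>\<eta> > 0\<close> by (intro order_tendstoD(2)) auto
    thus "eventually (\<lambda>n. dist (d n) 0 < \<eta>) sequentially"
    proof eventually_elim
      case (elim n)
      thus ?case using bound[OF \<epsilon>(1), of n] \<epsilon>(2) by simp
    qed
  qed
  from tendsto_add[OF this char[of t]]
  show "(\<lambda>n. char (distr (\<Omega> n) borel (V n)) t) \<longlonglongrightarrow> char L t"
    by (simp add: d_def)
qed

end

section \<open>AIPW scores in a randomised trial\<close>

text \<open>The score is affine in the outcome model, and this is its linear part. The outcome
  cancels, so only covariates and treatment remain.\<close>

definition contrast ::
  "(bool \<Rightarrow> real) \<Rightarrow> ('d::finite) outcome_model \<Rightarrow> 'd obs \<Rightarrow> real" where
  "contrast \<pi> u = (\<lambda>(x, a, y).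
     (1 - of_bool a / \<pi> True) * u x True - (1 - (1 - of_bool a) / \<pi> False) * u x False)"

lemma aipw_score_diff:
  "aipw_score \<pi> h z - aipw_score \<pi> h' z = contrast \<pi> (\<lambda>x a. h x a - h' x a) z"
  by (cases z) (simp add: aipw_score_def contrast_def algebra_simps add_divide_distrib diff_divide_distrib)

text \<open>Joint measurability in the training sample and the observation is what the slicing in
  \<open>conditional_tail_sum\<close> requires.\<close>

lemma measurable_contrast_param:
  assumes u: "\<And>a. (\<lambda>(t, x). u t x a) \<in> borel_measurable (N \<Otimes>\<^sub>M borel)"
  shows "(\<lambda>(t, z). contrast \<pi> (u t) z) \<in> borel_measurable (N \<Otimes>\<^sub>M obs_space)"
proof -
  have [measurable]: "(\<lambda>p. u (fst p) (fst (snd p)) a) \<in> borel_measurable (N \<Otimes>\<^sub>M obs_space)" for a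
  proof -
    have "(\<lambda>p. (fst p, fst (snd p))) \<in> N \<Otimes>\<^sub>M obs_space \<rightarrow>\<^sub>M N \<Otimes>\<^sub>M borel"
      by measurable
    from measurable_compose[OF this u[of a]] show ?thesis by simp
  qed
  show ?thesis
    unfolding contrast_def case_prod_beta by measurable
qed

lemma measurable_aipw_score:
  assumes [measurable]: "\<And>a. (\<lambda>x. h x a) \<in> borel_measurable borel"
  shows "aipw_score \<pi> h \<in> borel_measurable obs_space"
  unfolding aipw_score_def case_prod_beta by measurable

locale randomized_trial = prob_space P
  for P :: "'p measure" +
  fixes X :: "'p \<Rightarrow> real ^ 'd::finite" and A :: "'p \<Rightarrow> bool"
    and Ypot :: "bool \<Rightarrow> 'p \<Rightarrow> real" and Y :: "'p \<Rightarrow> real"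
    and \<pi> :: "bool \<Rightarrow> real" and \<theta> :: real
  assumes X [measurable]: "X \<in> P \<rightarrow>\<^sub>M borel"
    and A [measurable]: "A \<in> P \<rightarrow>\<^sub>M count_space UNIV"
    and Ypot [measurable]: "\<And>a. Ypot a \<in> P \<rightarrow>\<^sub>M borel"
    and Y: "\<And>p. Y p = Ypot (A p) p"
    and Y_bounded: "\<exists>B. AE p in P. \<bar>Y p\<bar> \<le> B"
    and Ypot_indep_A: "\<And>a. indep_rv P borel (Ypot a) (count_space UNIV) A"
    and X_indep_A: "indep_rv P borel X (count_space UNIV) A"
    and \<pi>: "\<And>a. \<pi> a = measure P {p \<in> space P. A p = a}" and \<pi>_pos: "\<And>a. \<pi> a > 0"
    and \<theta>: "\<theta> = (\<integral>p. (Ypot True p - Ypot False p) \<partial>P)"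
begin

definition obs :: "'p \<Rightarrow> 'd obs" where "obs p = (X p, A p, Y p)"

definition Q :: "'d obs measure" where "Q = distr P obs_space obs"

abbreviation \<mu> :: "(real ^ 'd) measure" where "\<mu> \<equiv> distr P borel X"

lemma measurable_Y [measurable]: "Y \<in> borel_measurable P"
proof -
  have "Y = (\<lambda>p. if A p then Ypot True p else Ypot False p)"
    using Y by (auto simp: fun_eq_iff)
  thus ?thesis by simp
qed

lemma measurable_obs [measurable]: "obs \<in> P \<rightarrow>\<^sub>M obs_space"
  unfolding obs_def by measurable

lemma prob_space_Q: "prob_space Q"
  unfolding Q_def by (rule prob_space_distr) measurable

lemma sets_Q [measurable_cong, simp]: "sets Q = sets obs_space"
  by (simp add: Q_def)

lemma integral_Q:
  fixes g :: "'d obs \<Rightarrow> real"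
  assumes "g \<in> borel_measurable obs_space"
  shows "(\<integral>z. g z \<partial>Q) = (\<integral>p. g (obs p) \<partial>P)" "integrable Q g \<longleftrightarrow> integrable P (\<lambda>p. g (obs p))"
  unfolding Q_def using assms by (simp_all add: integral_distr integrable_distr_eq)

lemma integral_A: "(\<integral>p. of_bool (A p) \<partial>P) = \<pi> True"
  "(\<integral>p. 1 - of_bool (A p) \<partial>P) = \<pi> False"
proof -
  have "(\<integral>p. of_bool (A p) \<partial>P) = (\<integral>p. (indicator {p \<in> space P. A p = True} p :: real) \<partial>P)"
    by (intro Bochner_Integration.integral_cong) (auto simp: indicator_def)
  thus "(\<integral>p. of_bool (A p) \<partial>P) = \<pi> True" by (simp add: \<pi>)
  have "(\<integral>p. 1 - of_bool (A p) \<partial>P) = (\<integral>p. (indicator {p \<in> space P. A p = False} p :: real) \<partial>P)"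
    by (intro Bochner_Integration.integral_cong) (auto simp: indicator_def)
  thus "(\<integral>p. 1 - of_bool (A p) \<partial>P) = \<pi> False" by (simp add: \<pi>)
qed

lemma integrable_A: "integrable P (\<lambda>p. c (A p) :: real)"
  by (rule integrable_const_bound[where B="max \<bar>c True\<bar> \<bar>c False\<bar>"])
     (auto intro!: AE_I2 simp: max_def split: bool.split, (metis (full_types) order.trans linorder_linear)+)

text \<open>The bound is assumed only for the observed outcome, which reveals \<open>Ypot a\<close>
  on the event \<open>A = a\<close>. The event that \<open>Ypot a\<close> exceeds the bound is
  independent of treatment and meets \<open>A = a\<close> in a null set; as \<open>\<pi> a\<close>
  is positive, it is itself null.\<close>

lemma Ypot_bounded: "\<exists>B. AE p in P. \<bar>Ypot a p\<bar> \<le> B"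
proof -
  from Y_bounded obtain B where B: "AE p in P. \<bar>Y p\<bar> \<le> B" by blast
  let ?U = "Ypot a -` {y. B < \<bar>y\<bar>} \<inter> space P" and ?V = "A -` {a} \<inter> space P"
  have meas: "{y::real. B < \<bar>y\<bar>} \<in> sets borel" by measurable
  have "?U \<inter> ?V \<in> null_sets P"
  proof (rule AE_iff_null_sets[THEN iffD2])
    show "?U \<inter> ?V \<in> sets P" using meas by measurable
    show "AE p in P. p \<notin> ?U \<inter> ?V"
      using B
    proof eventually_elim
      case (elim p)
      show ?case
      proof
        assume "p \<in> ?U \<inter> ?V"
        hence "A p = a" "B < \<bar>Ypot a p\<bar>" by auto
        with elim Y[of p] show False by simp
      qed
    qed
  qed
  hence "0 = prob (?U \<inter> ?V)" by (simp add: measure_def null_sets_def)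
  also have "\<dots> = prob ?U * prob ?V"
    by (rule indep_rv_D(3)[OF prob_space_axioms Ypot_indep_A meas]) simp
  also have "prob ?V = \<pi> a"
    unfolding \<pi> by (intro arg_cong[where f=prob]) auto
  finally have "prob ?U = 0" using \<pi>_pos[of a] by simp
  hence "?U \<in> null_sets P"
    using meas by (auto simp: null_sets_def emeasure_eq_measure)
  hence "AE p in P. p \<notin> ?U" by (rule AE_not_in)
  hence "AE p in P. \<bar>Ypot a p\<bar> \<le> B"
    using AE_space by eventually_elim (auto simp: not_less)
  thus ?thesis by blast
qed

lemma integrable_Ypot: "integrable P (Ypot a)"
proof -
  from Ypot_bounded[of a] obtain B where "AE p in P. \<bar>Ypot a p\<bar> \<le> B" by blast
  thus ?thesis by (intro integrable_const_bound[where B=B]) simp_all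
qed

lemma mean_zero_weight:
  "(\<integral>p. 1 - of_bool (A p) / \<pi> True \<partial>P) = 0"
  "(\<integral>p. 1 - (1 - of_bool (A p)) / \<pi> False \<partial>P) = 0"
proof -
  have "(\<integral>p. 1 - of_bool (A p) / \<pi> True \<partial>P) = 1 - (\<integral>p. of_bool (A p) \<partial>P) / \<pi> True"
    using integrable_A[of "\<lambda>a. of_bool a / \<pi> True"] by (subst Bochner_Integration.integral_diff) (auto simp: prob_space)
  thus "(\<integral>p. 1 - of_bool (A p) / \<pi> True \<partial>P) = 0"
    using \<pi>_pos[of True] by (simp add: integral_A)
  have "(\<integral>p. 1 - (1 - of_bool (A p)) / \<pi> False \<partial>P) = 1 - (\<integral>p. 1 - of_bool (A p) \<partial>P) / \<pi> False"
    using integrable_A[of "\<lambda>a. (1 - of_bool a) / \<pi> False"] by (subst Bochner_Integration.integral_diff) (auto simp: prob_space)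
  thus "(\<integral>p. 1 - (1 - of_bool (A p)) / \<pi> False \<partial>P) = 0"
    using \<pi>_pos[of False] by (simp add: integral_A)
qed

text \<open>A common bound for the coefficients of the model values in \<open>contrast\<close> and
  for the coefficient of the outcome in the score of the zero model.\<close>

definition score_bound :: real where "score_bound = 1 + 1 / \<pi> True + 1 / \<pi> False"

context
  fixes u :: "'d outcome_model"
  assumes u [measurable]: "\<And>a. (\<lambda>x. u x a) \<in> borel_measurable borel"
    and u_sq: "\<And>a. integrable \<mu> (\<lambda>x. (u x a)\<^sup>2)"
begin

lemma measurable_contrast: "contrast \<pi> u \<in> borel_measurable obs_space"
  unfolding contrast_def case_prod_beta by measurable

lemma integrable_model: "integrable P (\<lambda>p. (u (X p) a)\<^sup>2)" "integrable P (\<lambda>p. u (X p) a)"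
proof -
  show *: "integrable P (\<lambda>p. (u (X p) a)\<^sup>2)"
    using u_sq[of a] by (simp add: integrable_distr_eq)
  show "integrable P (\<lambda>p. u (X p) a)"
    by (rule square_integrable_imp_integrable[OF _ *]) measurable
qed

text \<open>Covariates are independent of treatment, so each term factors, and the
  inverse-probability weights have mean one. The identity is exact for every square-integrable
  \<open>u\<close>, however far the model is from the truth.\<close>

lemma contrast_mean: "(\<integral>z. contrast \<pi> u z \<partial>Q) = 0"
proof -
  let ?c = "\<lambda>a. 1 - of_bool a / \<pi> True" and ?c' = "\<lambda>a. 1 - (1 - of_bool a) / \<pi> False"
  have *: "(\<integral>p. u (X p) b * c (A p) \<partial>P) = (\<integral>p. u (X p) b \<partial>P) * (\<integral>p. c (A p) \<partial>P)"
    "integrable P (\<lambda>p. u (X p) b * c (A p))" for b c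
    by (rule indep_rv_integral_mult[OF prob_space_axioms X_indep_A], measurable,
        rule integrable_model, simp, rule integrable_A)+
  have "(\<integral>z. contrast \<pi> u z \<partial>Q)
      = (\<integral>p. u (X p) True * ?c (A p) - u (X p) False * ?c' (A p) \<partial>P)"
    unfolding integral_Q(1)[OF measurable_contrast]
    by (simp add: contrast_def obs_def mult.commute)
  also have "\<dots> = (\<integral>p. u (X p) True * ?c (A p) \<partial>P) - (\<integral>p. u (X p) False * ?c' (A p) \<partial>P)"
    by (rule Bochner_Integration.integral_diff[OF *(2) *(2)])
  also have "\<dots> = 0"
    unfolding *(1)[of True ?c] *(1)[of False ?c'] mean_zero_weight by simp
  finally show ?thesis .
qed

lemma contrast_sq_le:
  "(contrast \<pi> u (x, a, y))\<^sup>2 \<le> 2 * score_bound\<^sup>2 * ((u x True)\<^sup>2 + (u x False)\<^sup>2)"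
proof -
  define c where "c = 1 - of_bool a / \<pi> True"
  define c' where "c' = 1 - (1 - of_bool a) / \<pi> False"
  have pos: "1 / \<pi> True > 0" "1 / \<pi> False > 0" using \<pi>_pos by auto
  have "\<bar>c\<bar> \<le> score_bound" "\<bar>c'\<bar> \<le> score_bound"
    unfolding c_def c'_def score_bound_def using pos by (cases a; simp; linarith)+
  hence "c\<^sup>2 \<le> score_bound\<^sup>2" "c'\<^sup>2 \<le> score_bound\<^sup>2"
    by (metis abs_ge_zero power2_abs power_mono)+
  hence "2 * (c\<^sup>2 * (u x True)\<^sup>2 + c'\<^sup>2 * (u x False)\<^sup>2)
      \<le> 2 * (score_bound\<^sup>2 * (u x True)\<^sup>2 + score_bound\<^sup>2 * (u x False)\<^sup>2)"
    by (intro mult_left_mono add_mono mult_right_mono) auto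
  \<comment> \<open>The squares of sum and difference add up to twice the sum of squares; the square
    of the sum is dropped.\<close>
  moreover have "(c * u x True - c' * u x False)\<^sup>2 \<le> 2 * (c\<^sup>2 * (u x True)\<^sup>2 + c'\<^sup>2 * (u x False)\<^sup>2)"
    using zero_le_power2[of "c * u x True + c' * u x False"]
    by (simp add: power2_sum power2_diff power_mult_distrib)
  ultimately show ?thesis
    by (simp add: contrast_def c_def c'_def algebra_simps)
qed

lemma contrast_square_integrable: "integrable Q (\<lambda>z. (contrast \<pi> u z)\<^sup>2)"
  and contrast_second_moment: "(\<integral>z. (contrast \<pi> u z)\<^sup>2 \<partial>Q)
    \<le> 2 * score_bound\<^sup>2 * ((\<integral>x. (u x True)\<^sup>2 \<partial>\<mu>) + (\<integral>x. (u x False)\<^sup>2 \<partial>\<mu>))"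
proof -
  let ?b = "\<lambda>p. 2 * score_bound\<^sup>2 * ((u (X p) True)\<^sup>2 + (u (X p) False)\<^sup>2)"
  note [measurable] = measurable_contrast
  have b: "integrable P ?b"
    by (intro integrable_mult_right Bochner_Integration.integrable_add integrable_model)
  have le: "(contrast \<pi> u (obs p))\<^sup>2 \<le> ?b p" for p
    unfolding obs_def by (rule contrast_sq_le)
  have int: "integrable P (\<lambda>p. (contrast \<pi> u (obs p))\<^sup>2)"
    using le by (intro Bochner_Integration.integrable_bound[OF b]) (auto intro!: AE_I2 order.trans[OF le abs_ge_self])
  thus "integrable Q (\<lambda>z. (contrast \<pi> u z)\<^sup>2)"
    using integral_Q(2)[of "\<lambda>z. (contrast \<pi> u z)\<^sup>2"] by simp
  have "(\<integral>z. (contrast \<pi> u z)\<^sup>2 \<partial>Q) = (\<integral>p. (contrast \<pi> u (obs p))\<^sup>2 \<partial>P)"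
    by (rule integral_Q) simp
  also have "\<dots> \<le> (\<integral>p. ?b p \<partial>P)" by (rule integral_mono[OF int b le])
  also have "\<dots> = 2 * score_bound\<^sup>2 * ((\<integral>x. (u x True)\<^sup>2 \<partial>\<mu>) + (\<integral>x. (u x False)\<^sup>2 \<partial>\<mu>))"
    using integrable_model(1) by (simp add: integral_distr)
  finally show "(\<integral>z. (contrast \<pi> u z)\<^sup>2 \<partial>Q)
    \<le> 2 * score_bound\<^sup>2 * ((\<integral>x. (u x True)\<^sup>2 \<partial>\<mu>) + (\<integral>x. (u x False)\<^sup>2 \<partial>\<mu>))" .
qed

end

section \<open>Mean and second moment of the scores\<close>

lemma square_integrable_modelD:
  assumes "square_integrable_model \<mu> h"
  shows "(\<lambda>x. h x a) \<in> borel_measurable borel" "integrable \<mu> (\<lambda>x. (h x a)\<^sup>2)"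
  using assms by (auto simp: square_integrable_model_def)

text \<open>At the zero model the score is the Horvitz-Thompson (inverse-probability-weighted)
  score, which is unbiased because each potential outcome is independent of treatment.\<close>

lemma ipw_mean: "(\<integral>p. aipw_score \<pi> (\<lambda>_ _. 0) (obs p) \<partial>P) = \<theta>"
  and ipw_integrable: "integrable P (\<lambda>p. aipw_score \<pi> (\<lambda>_ _. 0) (obs p))"
proof -
  have *: "(\<integral>p. Ypot b p * c (A p) \<partial>P) = (\<integral>p. Ypot b p \<partial>P) * (\<integral>p. c (A p) \<partial>P)"
    "integrable P (\<lambda>p. Ypot b p * c (A p))" for b and c :: "bool \<Rightarrow> real"
    by (rule indep_rv_integral_mult[OF prob_space_axioms Ypot_indep_A, where g="\<lambda>y. y"], simp,
        rule integrable_Ypot, simp, rule integrable_A)+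
  let ?c = "\<lambda>a. of_bool a / \<pi> True" and ?c' = "\<lambda>a. (1 - of_bool a) / \<pi> False"
  \<comment> \<open>Each treatment indicator selects the arm in which the observed outcome is the
    corresponding potential outcome.\<close>
  have eq: "aipw_score \<pi> (\<lambda>_ _. 0) (obs p) = Ypot True p * ?c (A p) - Ypot False p * ?c' (A p)" for p
    by (cases "A p") (auto simp: aipw_score_def obs_def Y)
  show "integrable P (\<lambda>p. aipw_score \<pi> (\<lambda>_ _. 0) (obs p))"
    unfolding eq by (rule Bochner_Integration.integrable_diff[OF *(2) *(2)])
  have "(\<integral>p. aipw_score \<pi> (\<lambda>_ _. 0) (obs p) \<partial>P)
      = (\<integral>p. Ypot True p * ?c (A p) \<partial>P) - (\<integral>p. Ypot False p * ?c' (A p) \<partial>P)"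
    unfolding eq by (rule Bochner_Integration.integral_diff[OF *(2) *(2)])
  also have "\<dots> = (\<integral>p. Ypot True p \<partial>P) - (\<integral>p. Ypot False p \<partial>P)"
    unfolding *(1)[of True ?c] *(1)[of False ?c']
    using \<pi>_pos[of True] \<pi>_pos[of False] by (simp add: integral_A)
  finally show "(\<integral>p. aipw_score \<pi> (\<lambda>_ _. 0) (obs p) \<partial>P) = \<theta>"
    unfolding \<theta> by (simp add: integrable_Ypot)
qed

lemma ipw_square_integrable: "integrable P (\<lambda>p. (aipw_score \<pi> (\<lambda>_ _. 0) (obs p))\<^sup>2)"
proof -
  from Y_bounded obtain B where B: "AE p in P. \<bar>Y p\<bar> \<le> B" by blast
  have [measurable]: "aipw_score \<pi> (\<lambda>_ _. 0) \<in> borel_measurable (obs_space :: 'd obs measure)"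
    by (rule measurable_aipw_score) simp
  have "\<bar>aipw_score \<pi> (\<lambda>_ _. 0) (obs p)\<bar> \<le> score_bound * \<bar>Y p\<bar>" for p
  proof -
    have pos: "1 / \<pi> True > 0" "1 / \<pi> False > 0" using \<pi>_pos by auto
    have "\<bar>of_bool (A p) / \<pi> True - (1 - of_bool (A p)) / \<pi> False\<bar> \<le> score_bound"
      unfolding score_bound_def using pos by (cases "A p"; simp; linarith)
    moreover have "aipw_score \<pi> (\<lambda>_ _. 0) (obs p)
        = (of_bool (A p) / \<pi> True - (1 - of_bool (A p)) / \<pi> False) * Y p"
      by (cases "A p") (simp_all add: aipw_score_def obs_def)
    ultimately show ?thesis by (simp add: abs_mult mult_right_mono)
  qed
  note le = this
  have "AE p in P. norm ((aipw_score \<pi> (\<lambda>_ _. 0) (obs p))\<^sup>2) \<le> (score_bound * B)\<^sup>2"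
    using B
  proof eventually_elim
    case (elim p)
    have "score_bound \<ge> 0" using \<pi>_pos by (simp add: score_bound_def less_imp_le)
    with elim have "\<bar>aipw_score \<pi> (\<lambda>_ _. 0) (obs p)\<bar> \<le> score_bound * B"
      by (intro order.trans[OF le] mult_left_mono)
    thus ?case using power_mono[of "\<bar>aipw_score \<pi> (\<lambda>_ _. 0) (obs p)\<bar>" _ 2] by simp
  qed
  thus ?thesis by (intro integrable_const_bound) auto
qed

context
  fixes h :: "'d outcome_model"
  assumes h: "square_integrable_model \<mu> h"
begin

lemma measurable_score [measurable]: "aipw_score \<pi> h \<in> borel_measurable obs_space"
  by (intro measurable_aipw_score square_integrable_modelD(1)[OF h])

text \<open>Treatment is assumed independent of the covariates and of each potential outcome
  separately, not jointly. The split respects this: the first summand involves \<open>X\<close> and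
  \<open>A\<close>, the second only \<open>A\<close> and the outcome.\<close>

lemma score_eq: "aipw_score \<pi> h z = contrast \<pi> h z + aipw_score \<pi> (\<lambda>_ _. 0) z"
  using aipw_score_diff[of \<pi> h z "\<lambda>_ _. 0"] by simp

lemma score_square_integrable: "integrable P (\<lambda>p. (aipw_score \<pi> h (obs p))\<^sup>2)"
proof -
  note hD = square_integrable_modelD[OF h]
  note [measurable] = measurable_contrast[OF hD]
  have c: "integrable P (\<lambda>p. (contrast \<pi> h (obs p))\<^sup>2)"
    using contrast_square_integrable[OF hD] integral_Q(2)[of "\<lambda>z. (contrast \<pi> h z)\<^sup>2"] by simp
  have "(aipw_score \<pi> h (obs p))\<^sup>2
      \<le> 2 * ((contrast \<pi> h (obs p))\<^sup>2 + (aipw_score \<pi> (\<lambda>_ _. 0) (obs p))\<^sup>2)" for p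
    using zero_le_power2[of "contrast \<pi> h (obs p) - aipw_score \<pi> (\<lambda>_ _. 0) (obs p)"]
    by (simp add: score_eq[of "obs p"] power2_sum power2_diff)
  note le = this
  show ?thesis
    by (rule Bochner_Integration.integrable_bound[OF integrable_mult_right[OF
          Bochner_Integration.integrable_add[OF c ipw_square_integrable], of 2]])
       (measurable, intro AE_I2, simp only: real_norm_def abs_power2, rule order.trans[OF le abs_ge_self])
qed

lemma score_integrable: "integrable P (\<lambda>p. aipw_score \<pi> h (obs p))"
  by (rule square_integrable_imp_integrable[OF _ score_square_integrable]) measurable

lemma score_mean: "(\<integral>p. aipw_score \<pi> h (obs p) \<partial>P) = \<theta>"
proof -
  note hD = square_integrable_modelD[OF h]
  note [measurable] = measurable_contrast[OF hD]
  have "(\<integral>p. contrast \<pi> h (obs p) \<partial>P) = 0"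
    using contrast_mean[OF hD] integral_Q(1)[OF measurable_contrast[OF hD]] by simp
  moreover have "integrable P (\<lambda>p. contrast \<pi> h (obs p))"
    using contrast_square_integrable[OF hD] integral_Q(2)[of "\<lambda>z. (contrast \<pi> h z)\<^sup>2"]
    by (intro square_integrable_imp_integrable[where f="\<lambda>p. contrast \<pi> h (obs p)"]) simp_all
  ultimately show ?thesis
    unfolding score_eq using ipw_mean ipw_integrable by simp
qed

end

end

section \<open>Asymptotics of the hybrid estimator\<close>

text \<open>Indexing the first model by \<open>None\<close> lets all coordinates share one set of
  lemmas; only the replacement of the trained model by its limit treats \<open>None\<close>
  specially.\<close>

abbreviation model_family ::
  "('d::finite) outcome_model \<Rightarrow> ('k::finite \<Rightarrow> 'd outcome_model) \<Rightarrow> 'k option \<Rightarrow> 'd outcome_model" where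
  "model_family h f \<equiv> case_option h f"

lemma score_vec_nth: "score_vec \<pi> h f z $ j = aipw_score \<pi> (model_family h f j) z"
  by (cases j) (simp_all add: score_vec_def)

lemma hybrid_est_eq:
  "hybrid_est \<pi> n D h f w = (\<Sum>j\<in>UNIV. w $ j * aipw_est \<pi> n D (model_family h f j))"
  by (simp add: hybrid_est_def UNIV_option_conv sum.reindex)

lemma borel_measurable_dist_matrix:
  fixes F :: "'w \<Rightarrow> real^'n^'m"
  assumes "\<And>i j. (\<lambda>\<omega>. F \<omega> $ i $ j) \<in> borel_measurable M"
  shows "(\<lambda>\<omega>. dist (F \<omega>) C) \<in> borel_measurable M"
  unfolding dist_vec_def L2_set_def dist_real_def
  by (intro borel_measurable_sum borel_measurable_power borel_measurable_abs borel_measurable_diff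
      assms borel_measurable_const measurable_compose[OF _ borel_measurable_sqrt])

lemma borel_measurable_vec_nth:
  fixes F :: "'w \<Rightarrow> real^'n"
  assumes "F \<in> borel_measurable M"
  shows "(\<lambda>\<omega>. F \<omega> $ i) \<in> borel_measurable M"
  using assms by (rule borel_measurable_continuous_on[rotated]) (intro continuous_intros)

locale trial_samples = randomized_trial P X A Ypot Y \<pi> \<theta> + samples: prob_spaces \<Omega>
  for P :: "'p measure"
    and X :: "'p \<Rightarrow> real ^ 'd::finite" and A :: "'p \<Rightarrow> bool"
    and Ypot :: "bool \<Rightarrow> 'p \<Rightarrow> real" and Y :: "'p \<Rightarrow> real"
    and \<pi> :: "bool \<Rightarrow> real" and \<theta> :: real
    and \<Omega> :: "nat \<Rightarrow> 'w measure" +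
  fixes D :: "nat \<Rightarrow> nat \<Rightarrow> 'w \<Rightarrow> 'd obs"
    and N :: "nat \<Rightarrow> 't measure" and T :: "nat \<Rightarrow> 'w \<Rightarrow> 't"
    and train :: "nat \<Rightarrow> 't \<Rightarrow> 'd outcome_model"
    and h_lim :: "'d outcome_model" and f :: "'k::finite \<Rightarrow> 'd outcome_model"
  assumes D_indep: "\<And>n. prob_space.indep_vars (\<Omega> n) (\<lambda>_. obs_space) (D n) {..<n}"
    and D_law: "\<And>n i. i < n \<Longrightarrow> distr (\<Omega> n) obs_space (D n i) = Q"
    and T_indep_D: "\<And>n. indep_rv (\<Omega> n) (N n) (T n)
          (PiM {..<n} (\<lambda>_. obs_space)) (\<lambda>\<omega>. \<lambda>i\<in>{..<n}. D n i \<omega>)"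
    and train: "\<And>n a. (\<lambda>(t, x). train n t x a) \<in> N n \<Otimes>\<^sub>M borel \<rightarrow>\<^sub>M borel"
    and train_L2: "\<And>n. AE \<omega> in \<Omega> n. square_integrable_model \<mu> (train n (T n \<omega>))"
    and h_lim_L2: "square_integrable_model \<mu> h_lim"
    and train_tendsto: "\<And>a. tendsto_in_prob \<Omega>
          (\<lambda>n \<omega>. L2_norm_fun \<mu> (\<lambda>x. train n (T n \<omega>) x a - h_lim x a)) 0"
    and f_L2: "\<And>j. square_integrable_model \<mu> (f j)"
begin

lemma iid: "iid_sample (\<Omega> n) obs_space (D n) {..<n} Q"
  using D_indep D_law by (intro iid_sample.intro iid_sample_axioms.intro samples.prob_spaces) auto

lemma measurable_D [measurable]: "i < n \<Longrightarrow> D n i \<in> \<Omega> n \<rightarrow>\<^sub>M obs_space"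
  using iid_sample.measurable_sample[OF iid, of i n] by simp

lemma measurable_T [measurable]: "T n \<in> \<Omega> n \<rightarrow>\<^sub>M N n"
  by (rule indep_rv_D(1)[OF samples.prob_spaces T_indep_D])

abbreviation model :: "'k option \<Rightarrow> 'd outcome_model" where "model \<equiv> model_family h_lim f"

lemma model_L2: "square_integrable_model \<mu> (model j)"
  using h_lim_L2 f_L2 by (cases j) auto

section \<open>The mean-square error of the trained model and its effect on the estimator\<close>

definition dev :: "nat \<Rightarrow> 't \<Rightarrow> 'd outcome_model" where
  "dev n t = (\<lambda>x a. train n t x a - h_lim x a)"

lemma measurable_dev: "(\<lambda>(t, x). dev n t x a) \<in> borel_measurable (N n \<Otimes>\<^sub>M borel)"
proof -
  have [measurable]: "(\<lambda>x. h_lim x a) \<in> borel_measurable borel"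
    by (rule square_integrable_modelD(1)[OF h_lim_L2])
  have [measurable]: "(\<lambda>p. train n (fst p) (snd p) a) \<in> borel_measurable (N n \<Otimes>\<^sub>M borel)"
    using train[of n a] by (simp add: case_prod_beta')
  show ?thesis unfolding dev_def case_prod_beta' by measurable
qed

text \<open>The squared distance is a nonnegative integral, so it is infinite when the deviation is
  not square integrable, where the Bochner integral would default to 0. A finite bound on
  \<open>err\<close> thus carries integrability with it.\<close>

definition err :: "nat \<Rightarrow> 't \<Rightarrow> ennreal" where
  "err n t = (\<integral>\<^sup>+x. ennreal ((dev n t x True)\<^sup>2) \<partial>\<mu>) + (\<integral>\<^sup>+x. ennreal ((dev n t x False)\<^sup>2) \<partial>\<mu>)"

lemma prob_space_\<mu>: "prob_space \<mu>" by (rule prob_space_distr) measurable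

lemma measurable_dev': "(\<lambda>(t, x). dev n t x a) \<in> borel_measurable (N n \<Otimes>\<^sub>M \<mu>)"
  using measurable_dev[of n a] by (simp cong: measurable_cong_sets)

lemma measurable_err [measurable]: "err n \<in> borel_measurable (N n)"
proof -
  interpret \<mu>: prob_space \<mu> by (rule prob_space_\<mu>)
  have "(\<lambda>(t, x). ennreal ((dev n t x a)\<^sup>2)) \<in> borel_measurable (N n \<Otimes>\<^sub>M \<mu>)" for a
    using measurable_dev'[of n a] by (simp add: case_prod_beta')
  from \<mu>.borel_measurable_nn_integral[OF this]
  show ?thesis unfolding err_def by (intro borel_measurable_add) simp_all
qed

lemma measurable_L2_norm: "(\<lambda>\<omega>. L2_norm_fun \<mu> (\<lambda>x. dev n (T n \<omega>) x a)) \<in> borel_measurable (\<Omega> n)"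
proof -
  interpret \<mu>: prob_space \<mu> by (rule prob_space_\<mu>)
  have "(\<lambda>(t, x). (dev n t x a)\<^sup>2) \<in> borel_measurable (N n \<Otimes>\<^sub>M \<mu>)"
    using measurable_dev'[of n a] by (simp add: case_prod_beta')
  from \<mu>.borel_measurable_lebesgue_integral[OF this]
  have [measurable]: "(\<lambda>t. \<integral>x. (dev n t x a)\<^sup>2 \<partial>\<mu>) \<in> borel_measurable (N n)" .
  show ?thesis unfolding L2_norm_fun_def by measurable
qed

lemma dev_if_err_le:
  assumes t: "t \<in> space (N n)" and le: "err n t \<le> ennreal \<delta>" "\<delta> \<ge> 0"
  shows "\<And>a. (\<lambda>x. dev n t x a) \<in> borel_measurable borel"
    and "\<And>a. integrable \<mu> (\<lambda>x. (dev n t x a)\<^sup>2)"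
    and "(\<integral>x. (dev n t x True)\<^sup>2 \<partial>\<mu>) + (\<integral>x. (dev n t x False)\<^sup>2 \<partial>\<mu>) \<le> \<delta>"
proof -
  show [measurable]: "(\<lambda>x. dev n t x a) \<in> borel_measurable borel" for a
    using measurable_compose[OF measurable_Pair1'[OF t] measurable_dev[of n a]] by simp
  have le_err: "(\<integral>\<^sup>+x. ennreal ((dev n t x a)\<^sup>2) \<partial>\<mu>) \<le> err n t" for a
    unfolding err_def by (cases a) auto
  have err_fin: "err n t < \<infinity>" using le(1) by (rule order.strict_trans1) simp
  show int: "integrable \<mu> (\<lambda>x. (dev n t x a)\<^sup>2)" for a
    using order.strict_trans1[OF le_err err_fin] by (intro integrableI_nonneg) auto
  have err: "err n t = ennreal ((\<integral>x. (dev n t x True)\<^sup>2 \<partial>\<mu>) + (\<integral>x. (dev n t x False)\<^sup>2 \<partial>\<mu>))"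
    unfolding err_def by (simp add: nn_integral_eq_integral[OF int])
  show "(\<integral>x. (dev n t x True)\<^sup>2 \<partial>\<mu>) + (\<integral>x. (dev n t x False)\<^sup>2 \<partial>\<mu>) \<le> \<delta>"
    using le(1) unfolding err ennreal_le_iff[OF le(2)] .
qed

lemma err_tendsto:
  assumes "\<delta> > 0"
  shows "(\<lambda>n. measure (\<Omega> n) {\<omega> \<in> space (\<Omega> n). ennreal \<delta> < err n (T n \<omega>)}) \<longlonglongrightarrow> 0"
proof -
  define L where "L n a \<omega> = L2_norm_fun \<mu> (\<lambda>x. dev n (T n \<omega>) x a)" for n a \<omega>
  have [measurable]: "L n a \<in> borel_measurable (\<Omega> n)" for n a
    unfolding L_def by (rule measurable_L2_norm)
  \<comment> \<open>With both norms at most \<open>sqrt (\<delta> / 2)\<close>, the two squared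
    norms sum to at most \<open>\<delta>\<close>.\<close>
  define B where "B n a = {\<omega> \<in> space (\<Omega> n). sqrt (\<delta> / 2) < \<bar>L n a \<omega>\<bar>}" for n a
  have [measurable]: "B n a \<in> sets (\<Omega> n)" for n a unfolding B_def by measurable
  have lim: "(\<lambda>n. measure (\<Omega> n) (B n a)) \<longlonglongrightarrow> 0" for a
  proof -
    have "sqrt (\<delta> / 2) > 0" using assms by simp
    thus ?thesis
      using train_tendsto[of a] unfolding samples.tendsto_in_prob_0_iff B_def L_def dev_def by blast
  qed
  have le: "measure (\<Omega> n) {\<omega> \<in> space (\<Omega> n). ennreal \<delta> < err n (T n \<omega>)}
      \<le> measure (\<Omega> n) (B n True) + measure (\<Omega> n) (B n False)" for n
  proof -
    \<comment> \<open>The comparison holds only almost surely: where the trained model is not square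
      integrable, \<open>L2_norm_fun\<close> may fall to its default 0 while \<open>err\<close> is
      infinite.\<close>
    have "AE \<omega> in \<Omega> n. \<omega> \<in> {\<omega> \<in> space (\<Omega> n). ennreal \<delta> < err n (T n \<omega>)}
        \<longrightarrow> \<omega> \<in> B n True \<union> B n False"
      using train_L2[of n] AE_space
    proof eventually_elim
      case (elim \<omega>)
      let ?u = "dev n (T n \<omega>)"
      have int: "integrable \<mu> (\<lambda>x. (?u x a)\<^sup>2)" for a
      proof (rule Bochner_Integration.integrable_bound)
        show "integrable \<mu> (\<lambda>x. 2 * ((train n (T n \<omega>) x a)\<^sup>2 + (h_lim x a)\<^sup>2))"
          using square_integrable_modelD(2)[OF elim(1)] square_integrable_modelD(2)[OF h_lim_L2]
          by (intro integrable_mult_right Bochner_Integration.integrable_add)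
        have [measurable]: "(\<lambda>x. train n (T n \<omega>) x a) \<in> borel_measurable borel"
            "(\<lambda>x. h_lim x a) \<in> borel_measurable borel"
          using square_integrable_modelD(1)[OF elim(1)] square_integrable_modelD(1)[OF h_lim_L2] by auto
        show "(\<lambda>x. (?u x a)\<^sup>2) \<in> borel_measurable \<mu>"
          unfolding dev_def by measurable
        have "(?u x a)\<^sup>2 \<le> 2 * ((train n (T n \<omega>) x a)\<^sup>2 + (h_lim x a)\<^sup>2)" for x
          using zero_le_power2[of "train n (T n \<omega>) x a + h_lim x a"]
          by (simp add: dev_def power2_sum power2_diff)
        note le = this
        show "AE x in \<mu>. norm ((?u x a)\<^sup>2) \<le> norm (2 * ((train n (T n \<omega>) x a)\<^sup>2 + (h_lim x a)\<^sup>2))"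
          by (intro AE_I2, simp only: real_norm_def abs_power2, rule order.trans[OF le abs_ge_self])
      qed
      have nn: "(\<integral>x. (?u x a)\<^sup>2 \<partial>\<mu>) \<ge> 0" for a by (rule Bochner_Integration.integral_nonneg) simp
      have err: "err n (T n \<omega>) = ennreal ((\<integral>x. (?u x True)\<^sup>2 \<partial>\<mu>) + (\<integral>x. (?u x False)\<^sup>2 \<partial>\<mu>))"
        unfolding err_def using nn by (simp add: nn_integral_eq_integral[OF int])
      have sq: "(\<integral>x. (?u x a)\<^sup>2 \<partial>\<mu>) \<le> \<delta> / 2" if "\<omega> \<notin> B n a" for a
      proof -
        have "L n a \<omega> \<le> sqrt (\<delta> / 2)" using that elim(2) by (auto simp: B_def)
        thus ?thesis unfolding L_def L2_norm_fun_def by simp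
      qed
      show ?case
      proof (intro impI, rule ccontr)
        assume *: "\<omega> \<in> {\<omega> \<in> space (\<Omega> n). ennreal \<delta> < err n (T n \<omega>)}" "\<omega> \<notin> B n True \<union> B n False"
        hence "(\<integral>x. (?u x True)\<^sup>2 \<partial>\<mu>) + (\<integral>x. (?u x False)\<^sup>2 \<partial>\<mu>) \<le> \<delta>"
          using sq[of True] sq[of False] by simp
        hence "err n (T n \<omega>) \<le> ennreal \<delta>" unfolding err by (rule ennreal_leI)
        with * show False using leD by blast
      qed
    qed
    hence "measure (\<Omega> n) {\<omega> \<in> space (\<Omega> n). ennreal \<delta> < err n (T n \<omega>)} \<le> measure (\<Omega> n) (B n True \<union> B n False)"
      by (rule samples.finite_measure_mono_AE) measurable
    also have "\<dots> \<le> measure (\<Omega> n) (B n True) + measure (\<Omega> n) (B n False)"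
      by (intro measure_Un_le) measurable
    finally show ?thesis .
  qed
  have "(\<lambda>n. measure (\<Omega> n) (B n True) + measure (\<Omega> n) (B n False)) \<longlonglongrightarrow> 0"
    using tendsto_add[OF lim[of True] lim[of False]] by simp
  thus ?thesis
    by (rule tendsto_sandwich[OF always_eventually always_eventually tendsto_const, rotated 2])
       (use le in \<open>simp_all only: measure_nonneg simp_thms\<close>)
qed

text \<open>This is \<open>sqrt n\<close> times the change in the AIPW estimator when the limit
  model is replaced by the trained one (\<open>aipw_est_train\<close>).\<close>

definition H :: "nat \<Rightarrow> 'w \<Rightarrow> real" where
  "H n \<omega> = (\<Sum>i<n. contrast \<pi> (dev n (T n \<omega>)) (D n i \<omega>)) / sqrt n"

lemma measurable_contrast_dev [measurable]:
  assumes "i < n"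
  shows "(\<lambda>\<omega>. contrast \<pi> (dev n (T n \<omega>)) (D n i \<omega>)) \<in> borel_measurable (\<Omega> n)"
proof -
  have "(\<lambda>\<omega>. (T n \<omega>, D n i \<omega>)) \<in> \<Omega> n \<rightarrow>\<^sub>M N n \<Otimes>\<^sub>M obs_space"
    using measurable_D[OF assms] by measurable
  from measurable_compose[OF this measurable_contrast_param[OF measurable_dev]] show ?thesis by simp
qed

lemma measurable_H [measurable]: "H n \<in> borel_measurable (\<Omega> n)"
  unfolding H_def by (intro borel_measurable_divide borel_measurable_sum measurable_contrast_dev) auto

text \<open>Conditionally on the auxiliary sample, \<open>H n\<close> is a normalised sum of i.i.d. centred terms whose
  variance is controlled by \<open>err n\<close>.\<close>

lemma H_tendsto: "tendsto_in_prob \<Omega> H 0"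
  unfolding samples.tendsto_in_prob_0_eventually
proof (intro allI impI)
  fix \<epsilon> \<eta> :: real assume pos: "\<epsilon> > 0" "\<eta> > 0"
  define c where "c = 2 * score_bound\<^sup>2"
  have c: "c \<ge> 0" by (simp add: c_def)
  \<comment> \<open>Chosen so that the Chebyshev term
    \<open>c * \<delta> / \<epsilon>\<^sup>2\<close> is at most half of \<open>\<eta>\<close>;
    \<open>c + 1\<close> is positive knowing only \<open>c \<ge> 0\<close>.\<close>
  define \<delta> where "\<delta> = \<eta> / 2 * \<epsilon>\<^sup>2 / (c + 1)"
  have \<delta>: "\<delta> > 0" using pos c by (simp add: \<delta>_def)
  have "c * \<delta> \<le> (c + 1) * \<delta>" using \<delta> by (simp add: algebra_simps)
  also have "\<dots> = \<eta> / 2 * \<epsilon>\<^sup>2"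
  proof -
    have "c + 1 \<noteq> 0" using c by linarith
    thus ?thesis unfolding \<delta>_def times_divide_eq_right by (rule nonzero_mult_div_cancel_left)
  qed
  finally have small: "c * \<delta> / \<epsilon>\<^sup>2 \<le> \<eta> / 2" using pos by (simp add: pos_divide_le_eq)
  have tail: "measure (\<Omega> n) {\<omega> \<in> space (\<Omega> n). \<epsilon> < \<bar>H n \<omega>\<bar>}
      \<le> measure (\<Omega> n) {\<omega> \<in> space (\<Omega> n). ennreal \<delta> < err n (T n \<omega>)} + c * \<delta> / \<epsilon>\<^sup>2" for n
  proof -
    interpret iid_sample "\<Omega> n" obs_space "D n" "{..<n}" Q by (rule iid)
    have *: "integrable Q (\<lambda>z. (contrast \<pi> (dev n t) z)\<^sup>2)" "(\<integral>z. contrast \<pi> (dev n t) z \<partial>Q) = 0"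
        "(\<integral>z. (contrast \<pi> (dev n t) z)\<^sup>2 \<partial>Q) \<le> c * \<delta>"
      if t: "t \<in> space (N n)" "err n t \<le> ennreal \<delta>" for t
    proof -
      note dev = dev_if_err_le[OF t less_imp_le[OF \<delta>]]
      show "integrable Q (\<lambda>z. (contrast \<pi> (dev n t) z)\<^sup>2)"
        by (rule contrast_square_integrable[OF dev(1,2)])
      show "(\<integral>z. contrast \<pi> (dev n t) z \<partial>Q) = 0"
        by (rule contrast_mean[OF dev(1,2)])
      show "(\<integral>z. (contrast \<pi> (dev n t) z)\<^sup>2 \<partial>Q) \<le> c * \<delta>"
        unfolding c_def by (rule order.trans[OF contrast_second_moment[OF dev(1,2)] mult_left_mono[OF dev(3)]]) simp
    qed
    show ?thesis
      using conditional_tail_sum[OF finite_lessThan T_indep_D measurable_contrast_param[OF measurable_dev]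
          measurable_err *(1,2,3) pos(1)] c \<delta>
      unfolding H_def by simp
  qed
  have "eventually (\<lambda>n. measure (\<Omega> n) {\<omega> \<in> space (\<Omega> n). ennreal \<delta> < err n (T n \<omega>)} < \<eta> / 2) sequentially"
    using pos by (intro order_tendstoD(2)[OF err_tendsto[OF \<delta>]]) simp
  thus "eventually (\<lambda>n. measure (\<Omega> n) {\<omega> \<in> space (\<Omega> n). \<epsilon> < \<bar>H n \<omega>\<bar>} \<le> \<eta>) sequentially"
    by eventually_elim (use tail small in \<open>smt (verit) field_sum_of_halves\<close>)
qed

end

section \<open>Linear combinations of the limiting scores and their covariance\<close>

context trial_samples
begin

definition G :: "'k option \<Rightarrow> nat \<Rightarrow> 'w \<Rightarrow> real" where
  "G j n \<omega> = (\<Sum>i<n. aipw_score \<pi> (model j) (D n i \<omega>) - \<theta>) / sqrt n"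

lemma measurable_model_score [measurable]: "aipw_score \<pi> (model j) \<in> borel_measurable obs_space"
  by (rule measurable_score[OF model_L2])

lemma measurable_G [measurable]: "G j n \<in> borel_measurable (\<Omega> n)"
  unfolding G_def
  by (intro borel_measurable_divide borel_measurable_sum borel_measurable_diff
      measurable_compose[OF measurable_D measurable_model_score]) auto

definition cov :: "real ^ 'k option ^ 'k option" where
  "cov = cov_matrix P (\<lambda>p. score_vec \<pi> h_lim f (X p, A p, Y p))"

definition centred :: "'k option \<Rightarrow> 'd obs \<Rightarrow> real" where
  "centred j z = aipw_score \<pi> (model j) z - \<theta>"

lemma measurable_centred [measurable]: "centred j \<in> borel_measurable obs_space"
  unfolding centred_def by measurable

lemma centred_square_integrable: "integrable P (\<lambda>p. (centred j (obs p))\<^sup>2)"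
proof -
  have "integrable P (\<lambda>p. (aipw_score \<pi> (model j) (obs p))\<^sup>2 - 2 * \<theta> * aipw_score \<pi> (model j) (obs p) + \<theta>\<^sup>2)"
    using score_square_integrable[OF model_L2, of j] score_integrable[OF model_L2, of j] by simp
  thus ?thesis by (simp add: centred_def power2_diff algebra_simps)
qed

lemma centred_prod_integrable: "integrable P (\<lambda>p. centred i (obs p) * centred j (obs p))"
proof (rule Bochner_Integration.integrable_bound)
  show "integrable P (\<lambda>p. (centred i (obs p))\<^sup>2 + (centred j (obs p))\<^sup>2)"
    by (intro Bochner_Integration.integrable_add centred_square_integrable)
  have "\<bar>a * b\<bar> \<le> \<bar>a\<^sup>2 + b\<^sup>2\<bar>" for a b :: real
  proof -
    have "2 * (\<bar>a\<bar> * \<bar>b\<bar>) \<le> a\<^sup>2 + b\<^sup>2"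
      using zero_le_power2[of "\<bar>a\<bar> - \<bar>b\<bar>"] by (simp add: power2_diff)
    moreover have "0 \<le> \<bar>a\<bar> * \<bar>b\<bar>" by simp
    ultimately show ?thesis
      unfolding abs_mult using abs_ge_self[of "a\<^sup>2 + b\<^sup>2"] by linarith
  qed
  thus "AE p in P. norm (centred i (obs p) * centred j (obs p))
      \<le> norm ((centred i (obs p))\<^sup>2 + (centred j (obs p))\<^sup>2)"
    by (intro AE_I2) simp
qed measurable

lemma cov_nth: "cov $ i $ j = (\<integral>p. centred i (obs p) * centred j (obs p) \<partial>P)"
  using score_mean[OF model_L2]
  by (simp add: cov_def cov_matrix_def covariance_def score_vec_nth centred_def flip: obs_def)

definition combo :: "real ^ 'k option \<Rightarrow> 'd obs \<Rightarrow> real" where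
  "combo w z = (\<Sum>j\<in>UNIV. w $ j * centred j z)"

lemma measurable_combo [measurable]: "combo w \<in> borel_measurable obs_space"
  unfolding combo_def by measurable

lemma combo_sq: "(combo w z)\<^sup>2 = (\<Sum>i\<in>UNIV. \<Sum>j\<in>UNIV. w $ i * w $ j * (centred i z * centred j z))"
  unfolding combo_def power2_eq_square sum_product
  by (intro sum.cong refl) (simp only: mult_ac)

lemma combo_square_integrable: "integrable Q (\<lambda>z. (combo w z)\<^sup>2)"
proof -
  have "integrable P (\<lambda>p. (combo w (obs p))\<^sup>2)"
    unfolding combo_sq
    by (intro Bochner_Integration.integrable_sum integrable_mult_right centred_prod_integrable)
  thus ?thesis using integral_Q(2)[of "\<lambda>z. (combo w z)\<^sup>2"] by simp
qed

text \<open>Identifies the variance in the limit law and, being a second moment, also shows that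
  \<open>cov\<close> is positive semidefinite.\<close>

lemma combo_second_moment: "(\<integral>z. (combo w z)\<^sup>2 \<partial>Q) = quad_form cov w"
proof -
  have "(\<integral>z. (combo w z)\<^sup>2 \<partial>Q) = (\<integral>p. (combo w (obs p))\<^sup>2 \<partial>P)"
    by (rule integral_Q) simp
  also have "\<dots> = (\<Sum>i\<in>UNIV. \<Sum>j\<in>UNIV. w $ i * w $ j * cov $ i $ j)"
    unfolding combo_sq cov_nth
    by (simp add: Bochner_Integration.integral_sum Bochner_Integration.integrable_sum centred_prod_integrable)
  also have "\<dots> = quad_form cov w"
    by (simp add: quad_form_def inner_vec_def matrix_vector_mult_def sum_distrib_left mult_ac)
  finally show ?thesis .
qed

lemma combo_mean: "(\<integral>z. combo w z \<partial>Q) = 0"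
proof -
  have int: "integrable P (\<lambda>p. centred j (obs p))" for j
    unfolding centred_def using score_integrable[OF model_L2, of j] by simp
  have mean: "(\<integral>p. centred j (obs p) \<partial>P) = 0" for j
    unfolding centred_def using score_integrable[OF model_L2, of j] score_mean[OF model_L2, of j]
    by (simp add: prob_space)
  have "(\<integral>z. combo w z \<partial>Q) = (\<integral>p. combo w (obs p) \<partial>P)"
    by (rule integral_Q) simp
  also have "\<dots> = (\<Sum>j\<in>UNIV. w $ j * (\<integral>p. centred j (obs p) \<partial>P))"
    unfolding combo_def using int by (simp add: Bochner_Integration.integral_sum)
  finally show ?thesis by (simp add: mean)
qed

lemma cov_spd: "invertible cov \<Longrightarrow> spd_matrix cov"
proof
  show "transpose cov = cov"
    by (simp add: vec_eq_iff transpose_def cov_nth mult.commute)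
  show "quad_form cov w \<ge> 0" for w
    unfolding combo_second_moment[symmetric] by (rule Bochner_Integration.integral_nonneg) simp
qed

lemma combo_axis: "combo (axis j 1) = centred j"
proof
  show "combo (axis j 1) z = centred j z" for z
    unfolding combo_def axis_def by (simp add: if_distrib[of "\<lambda>x. x * _"] cong: if_cong)
qed

text \<open>The variance of the normalised sum does not grow with \<open>n\<close>, so a single
  Chebyshev bound serves all \<open>n\<close>.\<close>

lemma G_bounded: "samples.bounded_in_prob (G j)"
  unfolding samples.bounded_in_prob_def
proof (intro allI impI)
  fix \<eta> :: real assume \<eta>: "\<eta> > 0"
  define v where "v = (\<integral>z. (centred j z)\<^sup>2 \<partial>Q)"
  have v: "v \<ge> 0" unfolding v_def by (rule Bochner_Integration.integral_nonneg) simp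
  \<comment> \<open>Solves \<open>(v + 1) / K\<^sup>2 = \<eta>\<close>; the added 1 keeps
    \<open>K\<close> positive when the variance is zero.\<close>
  define K where "K = sqrt ((v + 1) / \<eta>)"
  have K: "K > 0" "v / K\<^sup>2 \<le> \<eta>" using v \<eta> by (auto simp: K_def divide_simps)
  have "measure (\<Omega> n) {\<omega> \<in> space (\<Omega> n). K < \<bar>G j n \<omega>\<bar>} \<le> \<eta>" for n
  proof -
    interpret iid_sample "\<Omega> n" obs_space "D n" "{..<n}" Q by (rule iid)
    have "measure (\<Omega> n) {\<omega> \<in> space (\<Omega> n). K < \<bar>(\<Sum>i\<in>{..<n}. centred j (D n i \<omega>)) / sqrt (card {..<n})\<bar>} \<le> v / K\<^sup>2"
      unfolding v_def
      using combo_square_integrable[of "axis j 1"] combo_mean[of "axis j 1"] K(1)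
      by (intro tail_sum) (simp_all add: combo_axis)
    with K(2) show ?thesis by (simp add: G_def centred_def)
  qed
  with K(1) show "\<exists>K>0. eventually (\<lambda>n. measure (\<Omega> n) {\<omega> \<in> space (\<Omega> n). K < \<bar>G j n \<omega>\<bar>} \<le> \<eta>) sequentially"
    by (intro exI[of _ K]) simp
qed

text \<open>For fixed weights, exchanging the two sums leaves one i.i.d. sum of the scalar function
  \<open>combo w\<close>, so a one-dimensional central limit theorem suffices.\<close>

lemma char_combo_tendsto:
  assumes "quad_form cov w > 0"
  shows "(\<lambda>n. char (distr (\<Omega> n) borel (\<lambda>\<omega>. \<Sum>j\<in>UNIV. w $ j * G j n \<omega>)) t)
    \<longlonglongrightarrow> char (normal_dist 0 (quad_form cov w)) t"
proof -
  have sum: "(\<Sum>j\<in>UNIV. w $ j * G j n \<omega>) = (\<Sum>i<n. combo w (D n i \<omega>)) / sqrt n" for n \<omega>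
  proof -
    have "(\<Sum>j\<in>UNIV. w $ j * G j n \<omega>)
        = (\<Sum>j\<in>UNIV. \<Sum>i<n. w $ j * centred j (D n i \<omega>)) / sqrt n"
      by (simp add: G_def centred_def sum_divide_distrib sum_distrib_left)
    also have "(\<Sum>j\<in>UNIV. \<Sum>i<n. w $ j * centred j (D n i \<omega>)) = (\<Sum>i<n. combo w (D n i \<omega>))"
      unfolding combo_def by (rule sum.swap)
    finally show ?thesis .
  qed
  have "char (distr (\<Omega> n) borel (\<lambda>\<omega>. \<Sum>j\<in>UNIV. w $ j * G j n \<omega>)) t
      = char (distr Q borel (combo w)) (t / sqrt n) ^ n" for n
    unfolding sum using iid_sample.char_sum[OF iid measurable_combo, of n w "sqrt n" t] by simp
  thus ?thesis
    using char_power_tendsto_normal[OF prob_space_Q _ combo_square_integrable combo_mean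
        combo_second_moment assms, of t] by simp
qed

section \<open>Decomposition of the scaled error\<close>

lemma aipw_est_lim: "sqrt n * (aipw_est \<pi> n (\<lambda>i. D n i \<omega>) (model j) - \<theta>) = G j n \<omega>"
proof (cases "n = 0")
  case True
  thus ?thesis by (simp add: G_def)
next
  case False
  hence "aipw_est \<pi> n (\<lambda>i. D n i \<omega>) (model j) - \<theta> = (\<Sum>i<n. aipw_score \<pi> (model j) (D n i \<omega>) - \<theta>) / n"
    by (simp add: aipw_est_def sum_subtractf diff_divide_distrib)
  moreover have "sqrt n * (a / n) = a / sqrt n" for a :: real
    using False by (simp add: field_simps)
  ultimately show ?thesis by (simp add: G_def)
qed

lemma aipw_est_train:
  "sqrt n * (aipw_est \<pi> n (\<lambda>i. D n i \<omega>) (train n (T n \<omega>)) - aipw_est \<pi> n (\<lambda>i. D n i \<omega>) h_lim) = H n \<omega>"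
proof (cases "n = 0")
  case True
  thus ?thesis by (simp add: H_def)
next
  case False
  have "aipw_est \<pi> n (\<lambda>i. D n i \<omega>) (train n (T n \<omega>)) - aipw_est \<pi> n (\<lambda>i. D n i \<omega>) h_lim
      = (\<Sum>i<n. contrast \<pi> (dev n (T n \<omega>)) (D n i \<omega>)) / n"
    by (simp add: aipw_est_def dev_def flip: aipw_score_diff sum_subtractf diff_divide_distrib)
  moreover have "sqrt n * (a / n) = a / sqrt n" for a :: real
    using False by (simp add: field_simps)
  ultimately show ?thesis by (simp add: H_def)
qed

text \<open>An identity for arbitrary \<open>w\<close>, because the estimated weights need not sum
  to one where the sample covariance is singular; the last term records that defect.\<close>

lemma hybrid_decomposition:
  "sqrt n * (hybrid_est \<pi> n (\<lambda>i. D n i \<omega>) (train n (T n \<omega>)) f w - \<theta>)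
    = (\<Sum>j\<in>UNIV. w $ j * G j n \<omega>) + w $ None * H n \<omega> + sqrt n * \<theta> * ((\<Sum>j\<in>UNIV. w $ j) - 1)"
proof -
  let ?e = "\<lambda>h. aipw_est \<pi> n (\<lambda>i. D n i \<omega>) h"
  have "hybrid_est \<pi> n (\<lambda>i. D n i \<omega>) (train n (T n \<omega>)) f w
      = hybrid_est \<pi> n (\<lambda>i. D n i \<omega>) h_lim f w + w $ None * (?e (train n (T n \<omega>)) - ?e h_lim)"
    by (simp add: hybrid_est_def algebra_simps)
  also have "hybrid_est \<pi> n (\<lambda>i. D n i \<omega>) h_lim f w
      = (\<Sum>j\<in>UNIV. w $ j * (?e (model j) - \<theta>)) + \<theta> * (\<Sum>j\<in>UNIV. w $ j)"
    unfolding hybrid_est_eq by (simp add: algebra_simps sum_subtractf sum_distrib_left)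
  finally have *: "hybrid_est \<pi> n (\<lambda>i. D n i \<omega>) (train n (T n \<omega>)) f w
      = (\<Sum>j\<in>UNIV. w $ j * (?e (model j) - \<theta>)) + \<theta> * (\<Sum>j\<in>UNIV. w $ j)
        + w $ None * (?e (train n (T n \<omega>)) - ?e h_lim)" .
  have "sqrt n * (\<Sum>j\<in>UNIV. w $ j * (?e (model j) - \<theta>))
      = (\<Sum>j\<in>UNIV. w $ j * (sqrt n * (?e (model j) - \<theta>)))"
    unfolding sum_distrib_left by (simp only: mult.left_commute)
  hence "sqrt n * (hybrid_est \<pi> n (\<lambda>i. D n i \<omega>) (train n (T n \<omega>)) f w - \<theta>)
      = (\<Sum>j\<in>UNIV. w $ j * (sqrt n * (?e (model j) - \<theta>)))
        + w $ None * (sqrt n * (?e (train n (T n \<omega>)) - ?e h_lim))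
        + sqrt n * \<theta> * ((\<Sum>j\<in>UNIV. w $ j) - 1)"
    unfolding * by (simp only: ring_distribs mult_ac diff_conv_add_uminus add_ac)
  thus ?thesis unfolding aipw_est_lim aipw_est_train .
qed

section \<open>Estimated covariance matrix, estimated weights and the limit law\<close>

definition scov :: "nat \<Rightarrow> 'w \<Rightarrow> real ^ 'k option ^ 'k option" where
  "scov n \<omega> = sample_cov n (\<lambda>i. score_vec \<pi> (train n (T n \<omega>)) f (D n i \<omega>))"

lemma measurable_score_vec:
  assumes i: "i < n"
  shows "(\<lambda>\<omega>. score_vec \<pi> (train n (T n \<omega>)) f (D n i \<omega>) $ j) \<in> borel_measurable (\<Omega> n)"
proof (cases j)
  case None
  have [measurable]: "aipw_score \<pi> h_lim \<in> borel_measurable obs_space"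
    by (rule measurable_score[OF h_lim_L2])
  have "aipw_score \<pi> (train n (T n \<omega>)) z
      = contrast \<pi> (dev n (T n \<omega>)) z + aipw_score \<pi> h_lim z" for \<omega> z
    using aipw_score_diff[of \<pi> "train n (T n \<omega>)" z h_lim] by (simp add: dev_def)
  thus ?thesis
    using None measurable_contrast_dev[OF i] measurable_compose[OF measurable_D[OF i], of "aipw_score \<pi> h_lim" borel]
    by (simp add: score_vec_def)
next
  case (Some l)
  thus ?thesis
    using measurable_compose[OF measurable_D[OF i] measurable_score[OF f_L2[of l]]]
    by (simp add: score_vec_def)
qed

lemma measurable_dist_scov: "(\<lambda>\<omega>. dist (scov n \<omega>) C) \<in> borel_measurable (\<Omega> n)"
proof (rule borel_measurable_dist_matrix)
  fix a b
  show "(\<lambda>\<omega>. scov n \<omega> $ a $ b) \<in> borel_measurable (\<Omega> n)"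
    unfolding scov_def sample_cov_def sample_mean_def vec_lambda_beta vector_minus_component
      vector_scaleR_component sum_component
    by (intro borel_measurable_times borel_measurable_const borel_measurable_sum borel_measurable_diff
        borel_measurable_scaleR measurable_score_vec) auto
qed

context
  fixes w_hat :: "nat \<Rightarrow> 'w \<Rightarrow> real ^ 'k option"
  assumes cov_inv: "invertible cov"
    and scov_tendsto: "tendsto_in_prob \<Omega> scov cov"
    and w_meas: "\<And>n. w_hat n \<in> \<Omega> n \<rightarrow>\<^sub>M borel"
    and w_hat: "\<And>n \<omega>. \<omega> \<in> space (\<Omega> n) \<Longrightarrow> invertible (scov n \<omega>) \<Longrightarrow> w_hat n \<omega> = inv_weights (scov n \<omega>)"
begin

interpretation spd: spd_matrix cov by (rule cov_spd[OF cov_inv])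

abbreviation (input) w_opt :: "real ^ 'k option" where "w_opt \<equiv> inv_weights cov"

text \<open>Close to \<open>cov\<close> every matrix is invertible, so the estimated weights are the
  continuous function \<open>inv_weights\<close> of the sample covariance there.\<close>

lemma w_hat_tendsto: "tendsto_in_prob \<Omega> (\<lambda>n \<omega>. w_hat n \<omega> $ j - w_opt $ j) 0"
proof (rule samples.tendsto_in_prob_0_if_eventually_nhds[OF scov_tendsto measurable_dist_scov])
  fix \<epsilon> :: real assume \<epsilon>: "\<epsilon> > 0"
  have "(inv_weights \<longlongrightarrow> w_opt) (nhds cov)"
    using spd.total_weight_pos by (intro tendsto_inv_weights cov_inv) simp
  from tendstoD[OF this \<epsilon>] eventually_invertible[OF cov_inv]
  show "eventually (\<lambda>u. \<forall>n. \<forall>\<omega>\<in>space (\<Omega> n). scov n \<omega> = u \<longrightarrow> \<bar>w_hat n \<omega> $ j - w_opt $ j\<bar> \<le> \<epsilon>) (nhds cov)"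
  proof eventually_elim
    case (elim u)
    show ?case
    proof (intro allI ballI impI)
      fix n \<omega> assume "\<omega> \<in> space (\<Omega> n)" "scov n \<omega> = u"
      with w_hat[of \<omega> n] elim have "dist (w_hat n \<omega>) w_opt < \<epsilon>" by simp
      thus "\<bar>w_hat n \<omega> $ j - w_opt $ j\<bar> \<le> \<epsilon>"
        using dist_vec_nth_le[of "w_hat n \<omega>" j w_opt] by (simp add: dist_real_def)
    qed
  qed
qed

text \<open>Continuity alone could not beat the factor \<open>sqrt n\<close>. Near
  \<open>cov\<close> the matrix is invertible and the normalising denominator is nonzero, so the
  weights sum to one exactly and the whole term is 0 for every \<open>n\<close>.\<close>

lemma weight_defect_tendsto:
  "tendsto_in_prob \<Omega> (\<lambda>n \<omega>. sqrt n * \<theta> * ((\<Sum>j\<in>UNIV. w_hat n \<omega> $ j) - 1)) 0"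
proof (rule samples.tendsto_in_prob_0_if_eventually_nhds[OF scov_tendsto measurable_dist_scov])
  fix \<epsilon> :: real assume \<epsilon>: "\<epsilon> > 0"
  have "((\<lambda>M. vec 1 \<bullet> (matrix_inv M *v vec 1)) \<longlongrightarrow> vec 1 \<bullet> (matrix_inv cov *v vec 1)) (nhds cov)"
    by (intro tendsto_intros tendsto_matrix_inv_mult cov_inv)
  hence "eventually (\<lambda>M. vec 1 \<bullet> (matrix_inv M *v vec 1) > 0) (nhds cov)"
    by (rule order_tendstoD(1)) (rule spd.total_weight_pos)
  with eventually_invertible[OF cov_inv]
  show "eventually (\<lambda>u. \<forall>n. \<forall>\<omega>\<in>space (\<Omega> n). scov n \<omega> = u \<longrightarrow>
      \<bar>sqrt n * \<theta> * ((\<Sum>j\<in>UNIV. w_hat n \<omega> $ j) - 1)\<bar> \<le> \<epsilon>) (nhds cov)"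
  proof eventually_elim
    case (elim u)
    show ?case
    proof (intro allI ballI impI)
      fix n \<omega> assume "\<omega> \<in> space (\<Omega> n)" "scov n \<omega> = u"
      with w_hat[of \<omega> n] elim have "w_hat n \<omega> = inv_weights u" by simp
      moreover have "inv_weights u \<in> weight_set"
        using elim(2) by (intro inv_weights_in_weight_set) simp
      ultimately show "\<bar>sqrt n * \<theta> * ((\<Sum>j\<in>UNIV. w_hat n \<omega> $ j) - 1)\<bar> \<le> \<epsilon>"
        using \<epsilon> by (simp add: weight_set_def)
    qed
  qed
qed

text \<open>The comparison variable uses the fixed weights \<open>w_opt\<close> and the limiting
  scores. The remainder consists of weight errors times the bounded \<open>G\<close>, the negligible
  \<open>H\<close> times an estimated weight, and the weight defect. Splitting that weight into
  \<open>w_opt\<close> plus its error makes every product one of a vanishing and a bounded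
  factor.\<close>

lemma hybrid_weak_conv:
  "weak_conv_m
     (\<lambda>n. distr (\<Omega> n) borel (\<lambda>\<omega>. sqrt n * (hybrid_est \<pi> n (\<lambda>i. D n i \<omega>) (train n (T n \<omega>)) f (w_hat n \<omega>) - \<theta>)))
     (normal_dist 0 (quad_form cov w_opt))"
  unfolding hybrid_decomposition
proof (rule samples.slutsky[where U="\<lambda>n \<omega>. \<Sum>j\<in>UNIV. w_opt $ j * G j n \<omega>"])
  note [measurable] = borel_measurable_vec_nth[OF w_meas]
  show "(\<lambda>\<omega>. \<Sum>j\<in>UNIV. w_opt $ j * G j n \<omega>) \<in> borel_measurable (\<Omega> n)" for n
    by measurable
  show "(\<lambda>\<omega>. (\<Sum>j\<in>UNIV. w_hat n \<omega> $ j * G j n \<omega>) + w_hat n \<omega> $ None * H n \<omega>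
      + sqrt n * \<theta> * ((\<Sum>j\<in>UNIV. w_hat n \<omega> $ j) - 1)) \<in> borel_measurable (\<Omega> n)" for n
    by measurable
  show "real_distribution (normal_dist 0 (quad_form cov w_opt))"
    by (rule real_distribution_normal_dist[OF spd.quad_form_inv_weights_pos])
  show "(\<lambda>n. char (distr (\<Omega> n) borel (\<lambda>\<omega>. \<Sum>j\<in>UNIV. w_opt $ j * G j n \<omega>)) t)
      \<longlonglongrightarrow> char (normal_dist 0 (quad_form cov w_opt)) t" for t
    by (rule char_combo_tendsto[OF spd.quad_form_inv_weights_pos])
  let ?d = "\<lambda>n \<omega> j. w_hat n \<omega> $ j - w_opt $ j"
  have GG: "tendsto_in_prob \<Omega> (\<lambda>n \<omega>. \<Sum>j\<in>UNIV. ?d n \<omega> j * G j n \<omega>) 0"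
    by (rule samples.tendsto_in_prob_sum[OF finite], measurable)
       (rule samples.tendsto_in_prob_mult[OF _ _ w_hat_tendsto G_bounded]; measurable)
  have HH: "tendsto_in_prob \<Omega> (\<lambda>n \<omega>. H n \<omega> * w_opt $ None) 0"
    by (rule samples.tendsto_in_prob_mult[OF _ _ H_tendsto samples.bounded_in_prob_const]; measurable)
  have dH: "tendsto_in_prob \<Omega> (\<lambda>n \<omega>. ?d n \<omega> None * H n \<omega>) 0"
    by (rule samples.tendsto_in_prob_mult[OF _ _ w_hat_tendsto
          samples.tendsto_in_prob_imp_bounded[OF H_tendsto]]; measurable)
  have dHH: "tendsto_in_prob \<Omega> (\<lambda>n \<omega>. ?d n \<omega> None * H n \<omega> + H n \<omega> * w_opt $ None) 0"
    by (rule samples.tendsto_in_prob_add[OF _ _ dH HH]; measurable)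
  have "tendsto_in_prob \<Omega> (\<lambda>n \<omega>. (\<Sum>j\<in>UNIV. ?d n \<omega> j * G j n \<omega>)
      + (?d n \<omega> None * H n \<omega> + H n \<omega> * w_opt $ None)) 0"
    by (rule samples.tendsto_in_prob_add[OF _ _ GG dHH]; measurable)
  from samples.tendsto_in_prob_add[OF _ _ this weight_defect_tendsto]
  have "tendsto_in_prob \<Omega> (\<lambda>n \<omega>. (\<Sum>j\<in>UNIV. ?d n \<omega> j * G j n \<omega>)
      + (?d n \<omega> None * H n \<omega> + H n \<omega> * w_opt $ None)
      + sqrt n * \<theta> * ((\<Sum>j\<in>UNIV. w_hat n \<omega> $ j) - 1)) 0"
    by measurable
  moreover have "(\<Sum>j\<in>UNIV. w_hat n \<omega> $ j * G j n \<omega>) + w_hat n \<omega> $ None * H n \<omega>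
        + sqrt n * \<theta> * ((\<Sum>j\<in>UNIV. w_hat n \<omega> $ j) - 1) - (\<Sum>j\<in>UNIV. w_opt $ j * G j n \<omega>)
      = (\<Sum>j\<in>UNIV. ?d n \<omega> j * G j n \<omega>) + (?d n \<omega> None * H n \<omega> + H n \<omega> * w_opt $ None)
        + sqrt n * \<theta> * ((\<Sum>j\<in>UNIV. w_hat n \<omega> $ j) - 1)" for n \<omega>
    unfolding left_diff_distrib[of _ _ "G _ n \<omega>"] sum_subtractf left_diff_distrib[of _ _ "H n \<omega>"] by simp
  ultimately show "tendsto_in_prob \<Omega> (\<lambda>n \<omega>. (\<Sum>j\<in>UNIV. w_hat n \<omega> $ j * G j n \<omega>) + w_hat n \<omega> $ None * H n \<omega>
      + sqrt n * \<theta> * ((\<Sum>j\<in>UNIV. w_hat n \<omega> $ j) - 1) - (\<Sum>j\<in>UNIV. w_opt $ j * G j n \<omega>)) 0"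
    by (simp only:)
qed

end

end

theorem theorem1:
  fixes P :: "'p measure"
    and X :: "'p \<Rightarrow> real ^ 'd::finite" and A :: "'p \<Rightarrow> bool"
    and Ypot :: "bool \<Rightarrow> 'p \<Rightarrow> real" and Y :: "'p \<Rightarrow> real"
    and \<pi> :: "bool \<Rightarrow> real" and \<theta> :: real
    and \<Omega> :: "nat \<Rightarrow> 'w measure" and D :: "nat \<Rightarrow> nat \<Rightarrow> 'w \<Rightarrow> 'd obs"
    and N :: "nat \<Rightarrow> 't measure" and T :: "nat \<Rightarrow> 'w \<Rightarrow> 't"
    and train :: "nat \<Rightarrow> 't \<Rightarrow> 'd outcome_model"
    and h_hat :: "nat \<Rightarrow> 'w \<Rightarrow> 'd outcome_model"
    and h_lim :: "'d outcome_model" and f :: "'k::finite \<Rightarrow> 'd outcome_model"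
    and S :: "real ^ 'k option ^ 'k option"
    and S_hat :: "nat \<Rightarrow> 'w \<Rightarrow> real ^ 'k option ^ 'k option"
    and w_hat :: "nat \<Rightarrow> 'w \<Rightarrow> real ^ 'k option" and w_opt :: "real ^ 'k option"
  \<comment> \<open>the population and the randomized experiment\<close>
  assumes P: "prob_space P"
    and X: "X \<in> P \<rightarrow>\<^sub>M borel" and A: "A \<in> P \<rightarrow>\<^sub>M count_space UNIV"
    and Ypot: "\<And>a. Ypot a \<in> P \<rightarrow>\<^sub>M borel"
    and Y: "\<And>p. Y p = Ypot (A p) p"
    and Y_bounded: "\<exists>B. AE p in P. \<bar>Y p\<bar> \<le> B"
    and Ypot_indep_A: "\<And>a. indep_rv P borel (Ypot a) (count_space UNIV) A"
    and X_indep_A: "indep_rv P borel X (count_space UNIV) A"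
    and \<pi>: "\<And>a. \<pi> a = measure P {p \<in> space P. A p = a}" and \<pi>_pos: "\<And>a. \<pi> a > 0"
    and \<theta>: "\<theta> = (\<integral>p. (Ypot True p - Ypot False p) \<partial>P)"
  \<comment> \<open>the i.i.d. data of size \<open>n\<close> and the independent auxiliary sample \<open>T n\<close>, under their joint law\<close>
    and \<Omega>: "\<And>n. prob_space (\<Omega> n)"
    and D_indep: "\<And>n. prob_space.indep_vars (\<Omega> n) (\<lambda>_. obs_space) (D n) {..<n}"
    and D_law: "\<And>n i. i < n \<Longrightarrow>
          distr (\<Omega> n) obs_space (D n i) = distr P obs_space (\<lambda>p. (X p, A p, Y p))"
    and T_indep_D: "\<And>n. indep_rv (\<Omega> n) (N n) (T n)
          (PiM {..<n} (\<lambda>_. obs_space)) (\<lambda>\<omega>. \<lambda>i\<in>{..<n}. D n i \<omega>)"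
  \<comment> \<open>the trained model, a function of the auxiliary sample, and its limit\<close>
    and train: "\<And>n a. (\<lambda>(t, x). train n t x a) \<in> N n \<Otimes>\<^sub>M borel \<rightarrow>\<^sub>M borel"
    and h_hat: "\<And>n \<omega>. h_hat n \<omega> = train n (T n \<omega>)"
    and h_hat_L2: "\<And>n. AE \<omega> in \<Omega> n. square_integrable_model (distr P borel X) (h_hat n \<omega>)"
    and h_lim_L2: "square_integrable_model (distr P borel X) h_lim"
    and h_hat_tendsto: "\<And>a. tendsto_in_prob \<Omega>
          (\<lambda>n \<omega>. L2_norm_fun (distr P borel X) (\<lambda>x. h_hat n \<omega> x a - h_lim x a)) 0"
    and f_L2: "\<And>j. square_integrable_model (distr P borel X) (f j)"
  \<comment> \<open>covariances and weights; the weights are unrestricted where \<open>S_hat\<close> is singular\<close>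
    and S: "S = cov_matrix P (\<lambda>p. score_vec \<pi> h_lim f (X p, A p, Y p))"
    and S_hat: "\<And>n \<omega>. S_hat n \<omega> = sample_cov n (\<lambda>i. score_vec \<pi> (h_hat n \<omega>) f (D n i \<omega>))"
    and S_invertible: "invertible S"
    and S_hat_tendsto: "tendsto_in_prob \<Omega> S_hat S"
    and w_hat_measurable: "\<And>n. w_hat n \<in> \<Omega> n \<rightarrow>\<^sub>M borel"
    and w_hat: "\<And>n \<omega>. \<omega> \<in> space (\<Omega> n) \<Longrightarrow> invertible (S_hat n \<omega>) \<Longrightarrow>
          w_hat n \<omega> = inv_weights (S_hat n \<omega>)"
    and w_opt: "w_opt = inv_weights S"
  shows "weak_conv_m
           (\<lambda>n. distr (\<Omega> n) borel (\<lambda>\<omega>. sqrt (real n) *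
              (hybrid_est \<pi> n (\<lambda>i. D n i \<omega>) (h_hat n \<omega>) f (w_hat n \<omega>) - \<theta>)))
           (normal_dist 0 (quad_form S w_opt))
       \<and> (\<forall>w. is_arg_min (quad_form S) (\<lambda>u. u \<in> weight_set) w \<longleftrightarrow> w = w_opt)
       \<and> (\<forall>j. quad_form S w_opt \<le> S $ j $ j)"
proof -
  have rt: "randomized_trial P X A Ypot Y \<pi> \<theta>"
    using P X A Ypot Y Y_bounded Ypot_indep_A X_indep_A \<pi> \<pi>_pos \<theta>
    by (intro randomized_trial.intro randomized_trial_axioms.intro)
  interpret randomized_trial P X A Ypot Y \<pi> \<theta> by (rule rt)
  interpret trial_samples P X A Ypot Y \<pi> \<theta> \<Omega> D N T train h_lim f
  proof (intro trial_samples.intro trial_samples_axioms.intro rt prob_spaces.intro)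
    show "distr (\<Omega> n) obs_space (D n i) = Q" if "i < n" for n i
      using D_law[OF that] by (simp add: Q_def obs_def[abs_def])
  qed (use \<Omega> D_indep T_indep_D train h_hat_L2 h_lim_L2 h_hat_tendsto f_L2 in \<open>simp_all add: h_hat\<close>)
  have S_cov: "S = cov" by (simp add: S cov_def)
  have S_hat_scov: "S_hat = scov" by (simp add: fun_eq_iff S_hat scov_def h_hat)
  interpret spd: spd_matrix S
    using cov_spd S_invertible by (simp add: S_cov)
  have "weak_conv_m
      (\<lambda>n. distr (\<Omega> n) borel (\<lambda>\<omega>. sqrt (real n) *
        (hybrid_est \<pi> n (\<lambda>i. D n i \<omega>) (h_hat n \<omega>) f (w_hat n \<omega>) - \<theta>)))
      (normal_dist 0 (quad_form S w_opt))"
    using hybrid_weak_conv[of w_hat] S_invertible S_hat_tendsto w_hat_measurable w_hat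
    by (simp add: S_cov S_hat_scov w_opt h_hat)
  thus ?thesis
    using spd.is_arg_min_iff spd.quad_form_inv_weights_le by (simp add: w_opt)
qed

end
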